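(* Let $G$ be a graph of order $n$ such that every connected component of $G$ has at least three vertices. There exists a polynomial-time algorithm that outputs a $\Delta$-completion set of $G$ of size at most $(\ln n+1)\cdot\Delta_G$; that is, the triangle-covered problem admits a polynomial-time $(\ln n+1)$-approximation algorithm.
   Context: All graphs are finite and simple. A graph is triangle-covered if every vertex belongs to at least one triangle. A $\Delta$-completion set of $G$ is a set $F$ of non-edges of $G$ such that $G+F$ is triangle-covered; $\Delta_G$ is the minimum size of a $\Delta$-completion set of $G$. *)

theory Defs
  imports Complex_Main "HOL-Computational_Algebra.Polynomial"
begin

section \<open>Simple graphs and triangle completion\<close>

text \<open>A graph is given by its vertex set \<open>V\<close> and its set \<open>E\<close> of two-element edges.\<close>

definition simple_graph :: "'a set \<Rightarrow> 'a set set \<Rightarrow> bool" where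
  "simple_graph V E \<longleftrightarrow> finite V \<and> (\<forall>e\<in>E. e \<subseteq> V \<and> card e = 2)"

definition connected_components :: "'a set \<Rightarrow> 'a set set \<Rightarrow> 'a set set" where
  "connected_components V E = V // ({(u, v). {u, v} \<in> E}\<^sup>* \<inter> V \<times> V)"

definition is_triangle :: "'a set \<Rightarrow> 'a set set \<Rightarrow> 'a set \<Rightarrow> bool" where
  "is_triangle V E T \<longleftrightarrow>
     T \<subseteq> V \<and> card T = 3 \<and> (\<forall>u\<in>T. \<forall>v\<in>T. u \<noteq> v \<longrightarrow> {u, v} \<in> E)"

definition triangle_covered :: "'a set \<Rightarrow> 'a set set \<Rightarrow> bool" where
  "triangle_covered V E \<longleftrightarrow> (\<forall>v\<in>V. \<exists>T. is_triangle V E T \<and> v \<in> T)"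

definition non_edges :: "'a set \<Rightarrow> 'a set set \<Rightarrow> 'a set set" where
  "non_edges V E = {e. e \<subseteq> V \<and> card e = 2 \<and> e \<notin> E}"

definition completion_set :: "'a set \<Rightarrow> 'a set set \<Rightarrow> 'a set set \<Rightarrow> bool" where
  "completion_set V E F \<longleftrightarrow> F \<subseteq> non_edges V E \<and> triangle_covered V (E \<union> F)"

text \<open>The minimum below is over a nonempty set as soon as \<open>V\<close> is empty or has at least three
  vertices; otherwise the value is unspecified.\<close>

definition min_completion :: "'a set \<Rightarrow> 'a set set \<Rightarrow> nat" where
  "min_completion V E = (LEAST k. \<exists>F. completion_set V E F \<and> card F = k)"

section \<open>Random access machine programs\<close>

text \<open>Algorithms are structured programs for a random access machine with registers and an
  indirectly addressed memory, all cells holding natural numbers. Arithmetic is restricted to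
  addition and truncated subtraction, each at unit cost. Without multiplication, the bit length
  of the numbers occurring in a run exceeds that of the input by at most an additive term linear in
  the cost, so polynomial cost on this machine is the same as polynomial time on Turing
  machines.\<close>

datatype exp =
    Const nat
  | Reg nat
  | Mem exp
  | Plus exp exp
  | Minus exp exp

datatype com =
    Skip
  | Assign nat exp
  | Store exp exp
  | Seq com com
  | If exp com com
  | While exp com

type_synonym state = "(nat \<Rightarrow> nat) \<times> (nat \<Rightarrow> nat)"

fun val :: "exp \<Rightarrow> state \<Rightarrow> nat" where
  "val (Const k) s = k"
| "val (Reg x) s = fst s x"
| "val (Mem e) s = snd s (val e s)"
| "val (Plus e f) s = val e s + val f s"
| "val (Minus e f) s = val e s - val f s"

fun cost :: "exp \<Rightarrow> nat" where
  "cost (Const k) = 1"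
| "cost (Reg x) = 1"
| "cost (Mem e) = cost e + 1"
| "cost (Plus e f) = cost e + cost f + 1"
| "cost (Minus e f) = cost e + cost f + 1"

text \<open>\<open>exec c s t s'\<close>: started in state \<open>s\<close>, the program \<open>c\<close> halts after \<open>t\<close> steps in
  state \<open>s'\<close>. A test succeeds iff its expression is nonzero.\<close>

inductive exec :: "com \<Rightarrow> state \<Rightarrow> nat \<Rightarrow> state \<Rightarrow> bool" where
  Skip: "exec Skip s 1 s"
| Assign: "exec (Assign x e) (r, m) (cost e + 1) (r(x := val e (r, m)), m)"
| Store: "exec (Store a e) (r, m) (cost a + cost e + 1) (r, m(val a (r, m) := val e (r, m)))"
| Seq: "exec c s t s' \<Longrightarrow> exec d s' t' s'' \<Longrightarrow> exec (Seq c d) s (t + t') s''"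
| If_True: "val e s \<noteq> 0 \<Longrightarrow> exec c s t s' \<Longrightarrow> exec (If e c d) s (cost e + t + 1) s'"
| If_False: "val e s = 0 \<Longrightarrow> exec d s t s' \<Longrightarrow> exec (If e c d) s (cost e + t + 1) s'"
| While_False: "val e s = 0 \<Longrightarrow> exec (While e c) s (cost e + 1) s"
| While_True: "val e s \<noteq> 0 \<Longrightarrow> exec c s t s' \<Longrightarrow> exec (While e c) s' t' s'' \<Longrightarrow>
    exec (While e c) s (cost e + t + t' + 1) s''"

lemma exec_deterministic:
  "exec c s t s' \<Longrightarrow> exec c s u s'' \<Longrightarrow> u = t \<and> s'' = s'"
proof (induction arbitrary: u s'' rule: exec.induct)
  case (Skip s)
  then show ?case by cases auto
next
  case (Assign x e r m)
  then show ?case by cases auto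
next
  case (Store a e r m)
  then show ?case by cases auto
next
  case (Seq c s t s' d t' s1)
  from Seq.prems show ?case
    by cases (metis Seq.IH)
next
  case (If_True e s c t s' d)
  from If_True.prems show ?case
    by cases (use If_True.hyps in \<open>metis If_True.IH\<close>)+
next
  case (If_False e s d t s' c)
  from If_False.prems show ?case
    by cases (use If_False.hyps in \<open>metis If_False.IH\<close>)+
next
  case (While_False e s c)
  from While_False.prems show ?case
    by cases (use While_False.hyps in auto)
next
  case (While_True e s c t s' t' s1)
  from While_True.prems show ?case
    by cases (use While_True.hyps(1) in \<open>metis While_True.IH\<close>)+
qed

text \<open>An edge set on the vertices \<open>0, ..., n - 1\<close> is represented by its 0-1 adjacency matrix, stored
  row by row in the memory cells \<open>0, ..., n * n - 1\<close>. The order \<open>n\<close> is passed in register 0, and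
  all other registers and memory cells are initially zero. The output matrix overwrites the input
  matrix; the other cells may then hold anything.\<close>

definition adjacency_matrix :: "nat \<Rightarrow> nat set set \<Rightarrow> nat \<Rightarrow> nat" where
  "adjacency_matrix n E a = (if a < n * n \<and> {a div n, a mod n} \<in> E then 1 else 0)"

definition input_state :: "nat \<Rightarrow> nat set set \<Rightarrow> state" where
  "input_state n E = ((\<lambda>_. 0)(0 := n), adjacency_matrix n E)"

definition outputs :: "nat \<Rightarrow> state \<Rightarrow> nat set set \<Rightarrow> bool" where
  "outputs n s F \<longleftrightarrow> (\<forall>a < n * n. snd s a = adjacency_matrix n F a)"

end

theory Submission
  imports Defs
begin

text \<open>Repeatedly add the non-edge that covers the most new vertices. The analysis of greedy set
  cover applies because \<open>card U \<le> g * card F\<close>, where \<open>U\<close> is the set of uncovered vertices, \<open>F\<close> any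
  completion set and \<open>g\<close> the largest gain of a single non-edge. To see this, call an edge of \<open>F\<close>
  useful if adding it alone covers some vertex of \<open>U\<close>; the useful edges account for at most \<open>g\<close>
  vertices each. Every remaining vertex of \<open>U\<close> is incident with an edge of \<open>F\<close>, and all such edges
  are useless, so there are at most two remaining vertices per useless edge, which settles the case
  \<open>g \<ge> 2\<close>. If \<open>g = 1\<close>, then no edge of the graph joins two vertices of \<open>U\<close>, since components have at
  least three vertices, and a finer count gives at most one remaining vertex per useless edge.\<close>

section \<open>Analysis of the greedy completion\<close>

definition covered :: "'a set \<Rightarrow> 'a set set \<Rightarrow> 'a set" where
  "covered V E = {v \<in> V. \<exists>T. is_triangle V E T \<and> v \<in> T}"

lemma triangle_covered_iff: "triangle_covered V E \<longleftrightarrow> covered V E = V"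
  by (auto simp: triangle_covered_def covered_def)

lemma simple_graph_edgeD:
  assumes "simple_graph V E" "{x, y} \<in> E"
  shows "x \<in> V" "y \<in> V" "x \<noteq> y"
proof -
  have "{x, y} \<subseteq> V" "card {x, y} = 2"
    using assms by (auto simp: simple_graph_def)
  then show "x \<in> V" "y \<in> V" "x \<noteq> y"
    by auto
qed

lemma simple_graph_finite:
  assumes "simple_graph V E"
  shows "finite V" "finite E"
proof -
  show "finite V"
    using assms by (simp add: simple_graph_def)
  moreover have "E \<subseteq> Pow V"
    using assms by (auto simp: simple_graph_def)
  ultimately show "finite E"
    by (meson finite_Pow_iff finite_subset)
qed

lemma triangle_at_vertex:
  assumes xy: "{x, y} \<in> E" and xz: "{x, z} \<in> E" and yz: "{y, z} \<in> E" and v: "v \<in> {x, y, z}"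
  shows "\<exists>a b. {v, a} \<in> E \<and> {v, b} \<in> E \<and> {a, b} \<in> E"
proof -
  have yx: "{y, x} \<in> E" and zx: "{z, x} \<in> E" and zy: "{z, y} \<in> E"
    using xy xz yz by (simp_all add: insert_commute)
  consider "v = x" | "v = y" | "v = z"
    using v by blast
  then show ?thesis
    using xy xz yz yx zx zy by cases blast+
qed

text \<open>In a simple graph, three edges among \<open>v\<close>, \<open>a\<close>,
  \<open>b\<close> already force these to be distinct, so coverage can be handled by edge membership
  alone.\<close>

lemma covered_iff:
  assumes "simple_graph V E"
  shows "v \<in> covered V E \<longleftrightarrow> (\<exists>a b. {v, a} \<in> E \<and> {v, b} \<in> E \<and> {a, b} \<in> E)"
proof
  assume "v \<in> covered V E"
  then obtain T where T: "is_triangle V E T" "v \<in> T"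
    by (auto simp: covered_def)
  then obtain x y z where xyz: "T = {x, y, z}" "x \<noteq> y" "y \<noteq> z" "x \<noteq> z"
    by (auto simp: is_triangle_def card_3_iff)
  with T have "{x, y} \<in> E" "{y, z} \<in> E" "{x, z} \<in> E"
    by (auto simp: is_triangle_def)
  with T(2) xyz(1) show "\<exists>a b. {v, a} \<in> E \<and> {v, b} \<in> E \<and> {a, b} \<in> E"
    using triangle_at_vertex by metis
next
  assume "\<exists>a b. {v, a} \<in> E \<and> {v, b} \<in> E \<and> {a, b} \<in> E"
  then obtain a b where ab: "{v, a} \<in> E" "{v, b} \<in> E" "{a, b} \<in> E"
    by auto
  note D = simple_graph_edgeD[OF assms]
  have "is_triangle V E {v, a, b}"
    using ab D[OF ab(1)] D[OF ab(2)] D[OF ab(3)]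
    by (auto simp: is_triangle_def insert_commute)
  then show "v \<in> covered V E"
    using D[OF ab(1)] by (auto simp: covered_def)
qed

lemma covered_mono: "E \<subseteq> E' \<Longrightarrow> covered V E \<subseteq> covered V E'"
  by (auto simp: covered_def is_triangle_def; blast)

lemma covered_subset: "covered V E \<subseteq> V"
  by (auto simp: covered_def)

lemma non_edges_doubleton:
  "{x, y} \<in> non_edges V E \<longleftrightarrow> x \<in> V \<and> y \<in> V \<and> x \<noteq> y \<and> {x, y} \<notin> E"
  by (cases "x = y") (auto simp: non_edges_def)

lemma non_edgesE:
  assumes "e \<in> non_edges V E"
  obtains x y where "e = {x, y}" "x \<in> V" "y \<in> V" "x \<noteq> y" "e \<notin> E"
  using assms by (auto simp: non_edges_def card_2_iff)

lemma finite_non_edges: "finite V \<Longrightarrow> finite (non_edges V E)"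
  by (rule finite_subset[of _ "Pow V"]) (auto simp: non_edges_def)

lemma simple_graph_Un_non_edges:
  "simple_graph V E \<Longrightarrow> F \<subseteq> non_edges V E \<Longrightarrow> simple_graph V (E \<union> F)"
  by (auto simp: simple_graph_def non_edges_def)

lemma simple_graph_insert_non_edge:
  "simple_graph V E \<Longrightarrow> e \<in> non_edges V E \<Longrightarrow> simple_graph V (insert e E)"
  using simple_graph_Un_non_edges[of V E "{e}"] by simp

section \<open>Components with at least three vertices\<close>

text \<open>A local form of the condition on components: \<open>v\<close> is an end or the middle of
  a path on three vertices. In this form it plainly survives the addition of edges.\<close>

definition large_components :: "'a set \<Rightarrow> 'a set set \<Rightarrow> bool" where
  "large_components V E \<longleftrightarrow>
     (\<forall>v\<in>V. \<exists>a b. b \<notin> {v, a} \<and> {v, a} \<in> E \<and> ({v, b} \<in> E \<or> {a, b} \<in> E))"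

lemma large_components_mono:
  "large_components V E \<Longrightarrow> E \<subseteq> E' \<Longrightarrow> large_components V E'"
  unfolding large_components_def by (meson subsetD)

text \<open>A set that contains \<open>v\<close> and is closed under adjacency contains the
  component of \<open>v\<close>. A component of three vertices fits neither in \<open>{v}\<close>
  nor in \<open>{v, a}\<close>, and edges leaving these two sets give the path.\<close>

lemma large_components_if_card_ge_3:
  assumes G: "simple_graph V E" and C: "\<forall>C\<in>connected_components V E. card C \<ge> 3"
  shows "large_components V E"
  unfolding large_components_def
proof
  fix v assume v: "v \<in> V"
  define R where "R = {(u, v). {u, v} \<in> E}"
  define K where "K = (R\<^sup>* \<inter> V \<times> V) `` {v}"
  have "K \<in> connected_components V E"
    using v by (auto simp: connected_components_def K_def R_def quotient_def)
  with C have K3: "card K \<ge> 3"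
    by auto
  have closed: "K \<subseteq> X" if "v \<in> X" "\<And>x y. x \<in> X \<Longrightarrow> {x, y} \<in> E \<Longrightarrow> y \<in> X" for X
  proof
    fix y assume "y \<in> K"
    then have "(v, y) \<in> R\<^sup>*"
      by (simp add: K_def)
    then show "y \<in> X"
      by induction (use that in \<open>auto simp: R_def\<close>)
  qed
  have card_le: "\<not> K \<subseteq> {v, a}" for a
  proof
    assume "K \<subseteq> {v, a}"
    then have "card K \<le> card {v, a}"
      by (intro card_mono) auto
    also have "\<dots> \<le> 2"
      by (simp add: card_insert_if)
    finally show False
      using K3 by simp
  qed
  have "\<exists>a. {v, a} \<in> E"
    using closed[of "{v}"] card_le[of v] by auto
  then obtain a where a: "{v, a} \<in> E" ..
  with simple_graph_edgeD[OF G a] closed[of "{v, a}"] card_le[of a]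
  show "\<exists>a b. b \<notin> {v, a} \<and> {v, a} \<in> E \<and> ({v, b} \<in> E \<or> {a, b} \<in> E)"
    by blast
qed

text \<open>Some third vertex \<open>w\<close> is adjacent to \<open>v\<close> or to
  \<open>a\<close>. It is not adjacent to both, as \<open>v\<close> is uncovered, so the missing
  pair is a non-edge whose addition makes \<open>v\<close>, \<open>a\<close>, \<open>w\<close> a
  triangle.\<close>

lemma edge_closing_path:
  assumes G: "simple_graph V E" and L: "large_components V E"
    and v: "v \<in> V - covered V E" and va: "{v, a} \<in> E"
  obtains e where "e \<in> non_edges V E" "v \<in> covered V (insert e E)" "a \<in> covered V (insert e E)"
proof -
  \<comment> \<open>The path supplied at \<open>v\<close> may avoid \<open>a\<close>. Its vertex
    \<open>x\<close> serves as \<open>w\<close> if it differs from \<open>a\<close>, and otherwise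
    \<open>y\<close> does.\<close>
  obtain w where w: "w \<notin> {v, a}" "{v, w} \<in> E \<or> {a, w} \<in> E"
  proof -
    from L v obtain x y where "y \<notin> {v, x}" "{v, x} \<in> E" "{v, y} \<in> E \<or> {x, y} \<in> E"
      by (auto simp: large_components_def)
    then show ?thesis
      using that[of x] that[of y] simple_graph_edgeD[OF G \<open>{v, x} \<in> E\<close>] by blast
  qed
  define e where "e = (if {v, w} \<in> E then {a, w} else {v, w})"
  have not_both: "\<not> ({v, w} \<in> E \<and> {a, w} \<in> E)"
    using v va covered_iff[OF G, of v] by blast
  have "w \<in> V"
    using w simple_graph_edgeD[OF G] by blast
  then have e: "e \<in> non_edges V E"
    using not_both w v simple_graph_edgeD[OF G va] by (auto simp: e_def non_edges_doubleton)
  have tri: "{v, a} \<in> insert e E" "{v, w} \<in> insert e E" "{a, w} \<in> insert e E"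
    using w va by (auto simp: e_def)
  note iff = covered_iff[OF simple_graph_insert_non_edge[OF G e]]
  have "v \<in> covered V (insert e E)"
    unfolding iff using tri by blast
  moreover have "a \<in> covered V (insert e E)"
    unfolding iff using tri by (metis insert_commute)
  ultimately show ?thesis
    using e that by blast
qed

section \<open>Charging vertices to edges\<close>

text \<open>The finer count for maximum gain one. Vertices of \<open>A\<close> are charged to an
  edge leaving \<open>U\<close>, those of \<open>B\<close> to an edge into \<open>A\<close>, and
  those of \<open>C\<close> have two edges each inside \<open>U - A\<close>. The three classes of
  edges are pairwise disjoint.\<close>

lemma card_le_card_edges:
  assumes fin: "finite U" "finite D" and D2: "\<And>e. e \<in> D \<Longrightarrow> card e = 2"
    and U: "\<And>v. v \<in> U \<Longrightarrow> (\<exists>a b. a \<noteq> b \<and> {v, a} \<in> D \<and> {v, b} \<in> D) \<or>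
      (\<exists>a b. {v, b} \<in> D \<and> a \<notin> U \<and> (b \<in> U \<longrightarrow> {a, b} \<in> D))"
  shows "card U \<le> card D"
proof -
  define A where "A = {v \<in> U. \<exists>x. x \<notin> U \<and> {v, x} \<in> D}"
  define B where "B = {v \<in> U - A. \<exists>x\<in>A. {v, x} \<in> D}"
  define C where "C = U - A - B"
  define DA where "DA = {e \<in> D. \<not> e \<subseteq> U}"
  define DB where "DB = {e \<in> D. e \<subseteq> U \<and> e \<inter> A \<noteq> {}}"
  define DC where "DC = {e \<in> D. e \<subseteq> U - A}"
  have "\<forall>v\<in>A. \<exists>x. x \<notin> U \<and> {v, x} \<in> D"
    by (auto simp: A_def)
  then obtain f where f: "\<And>v. v \<in> A \<Longrightarrow> f v \<notin> U \<and> {v, f v} \<in> D"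
    by metis
  have "card A \<le> card DA"
  proof (rule card_inj_on_le)
    show "inj_on (\<lambda>v. {v, f v}) A"
      using f by (auto simp: inj_on_def doubleton_eq_iff A_def)
    show "(\<lambda>v. {v, f v}) ` A \<subseteq> DA"
      using f by (auto simp: DA_def)
  qed (use fin in \<open>simp add: DA_def\<close>)
  moreover
  have "\<forall>v\<in>B. \<exists>x\<in>A. {v, x} \<in> D"
    by (auto simp: B_def)
  then obtain h where h: "\<And>v. v \<in> B \<Longrightarrow> h v \<in> A \<and> {v, h v} \<in> D"
    by metis
  have "card B \<le> card DB"
  proof (rule card_inj_on_le)
    show "inj_on (\<lambda>v. {v, h v}) B"
      using h by (auto simp: inj_on_def doubleton_eq_iff B_def)
    show "(\<lambda>v. {v, h v}) ` B \<subseteq> DB"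
      using h by (auto simp: DB_def A_def B_def)
  qed (use fin in \<open>simp add: DB_def\<close>)
  moreover
  have "card C \<le> card DC"
  proof -
    have fin': "finite C" "finite DC"
      using fin by (auto simp: C_def DC_def)
    have deg: "2 \<le> card {e \<in> DC. v \<in> e}" if v: "v \<in> C" for v
    proof -
      have v': "v \<in> U" "v \<notin> A" "v \<notin> B"
        using v by (auto simp: C_def)
      have inner: "x \<in> U - A" if "{v, x} \<in> D" for x
        using v' that by (auto simp: A_def B_def)
      \<comment> \<open>In the other alternative, \<open>b\<close> would be a vertex of
        \<open>U\<close> joined to \<open>a\<close> outside \<open>U\<close>, hence in
        \<open>A\<close>; but by \<open>inner\<close> no edge of \<open>D\<close> leads from
        \<open>v\<close> to \<open>A\<close>.\<close>
      have "\<exists>a b. a \<noteq> b \<and> {v, a} \<in> D \<and> {v, b} \<in> D"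
      proof (rule ccontr)
        assume "\<not> ?thesis"
        with U[OF v'(1)] obtain a b where ab: "{v, b} \<in> D" "a \<notin> U" "b \<in> U \<longrightarrow> {a, b} \<in> D"
          by auto
        with inner[of b] have "b \<in> A"
          by (auto simp: A_def insert_commute)
        with inner[OF ab(1)] show False
          by simp
      qed
      then obtain a b where ab: "a \<noteq> b" "{v, a} \<in> D" "{v, b} \<in> D"
        by auto
      then have "{{v, a}, {v, b}} \<subseteq> {e \<in> DC. v \<in> e}"
        using v' inner by (auto simp: DC_def)
      from card_mono[OF _ this] ab(1) fin' show ?thesis
        by (simp add: doubleton_eq_iff)
    qed
    \<comment> \<open>Double counting of incidences: at least two per vertex of \<open>C\<close>, at
      most two per edge of \<open>DC\<close>.\<close>
    have "2 * card C \<le> (\<Sum>v\<in>C. card {e \<in> DC. v \<in> e})"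
      using sum_mono[of C "\<lambda>_. 2" "\<lambda>v. card {e \<in> DC. v \<in> e}"] deg by simp
    also have "\<dots> = (\<Sum>v\<in>C. \<Sum>e | e \<in> DC \<and> v \<in> e. 1)"
      by simp
    also have "\<dots> = (\<Sum>e\<in>DC. \<Sum>v | v \<in> C \<and> v \<in> e. 1)"
      by (rule sum.swap_restrict) (use fin' in auto)
    also have "\<dots> \<le> (\<Sum>e\<in>DC. 2)"
    proof (rule sum_mono)
      fix e assume "e \<in> DC"
      then have "card e = 2"
        using D2 by (simp add: DC_def)
      then have "card {v. v \<in> C \<and> v \<in> e} \<le> 2"
        using card_mono[of e "{v. v \<in> C \<and> v \<in> e}"] card.infinite[of e] by fastforce
      then show "(\<Sum>v | v \<in> C \<and> v \<in> e. 1) \<le> (2::nat)"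
        by simp
    qed
    finally show ?thesis
      by simp
  qed
  moreover have "card U = card A + card B + card C"
  proof -
    have "U = A \<union> B \<union> C" "A \<inter> B = {}" "(A \<union> B) \<inter> C = {}"
      by (auto simp: A_def B_def C_def)
    then show ?thesis
      using fin(1) by (metis card_Un_disjoint finite_Un)
  qed
  moreover have "card DA + card DB + card DC \<le> card D"
  proof -
    have "DA \<union> DB \<union> DC \<subseteq> D" "DA \<inter> DB = {}"
      by (auto simp: DA_def DB_def DC_def)
    moreover have "(DA \<union> DB) \<inter> DC = {}"
      by (auto simp: DA_def DB_def DC_def)
    ultimately show ?thesis
      using fin(2) by (metis card_Un_disjoint card_mono finite_Un finite_subset)
  qed
  ultimately show ?thesis
    by simp
qed

section \<open>Gain of a single non-edge\<close>

definition gain :: "'a set \<Rightarrow> 'a set set \<Rightarrow> 'a set \<Rightarrow> nat" where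
  "gain V E e = card (covered V (insert e E) - covered V E)"

text \<open>Closing a path at an uncovered vertex has positive gain, so the greedy process cannot
  stall before everything is covered.\<close>

lemma gain_pos:
  assumes G: "simple_graph V E" and L: "large_components V E" and v: "v \<in> V - covered V E"
  shows "\<exists>e\<in>non_edges V E. gain V E e > 0"
proof -
  from L v obtain a where "{v, a} \<in> E"
    by (auto simp: large_components_def)
  from edge_closing_path[OF G L v this] obtain e
    where e: "e \<in> non_edges V E" "v \<in> covered V (insert e E)" .
  moreover have "finite (covered V (insert e E))"
    using simple_graph_finite(1)[OF G] covered_subset by (metis finite_subset)
  ultimately show ?thesis
    using v by (auto simp: gain_def card_gt_0_iff intro!: bexI[of _ e])
qed

text \<open>The inequality behind the greedy set cover analysis. It is not inherited from set cover,
  since edges of \<open>F\<close> may cover a vertex only jointly; such vertices form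
  \<open>U2\<close> and are charged to \<open>F2\<close>, the edges that cover nothing new on their
  own.\<close>

lemma card_uncovered_le:
  assumes G: "simple_graph V E" and L: "large_components V E" and F: "completion_set V E F"
    and g: "\<And>e. e \<in> non_edges V E \<Longrightarrow> gain V E e \<le> g"
  shows "card (V - covered V E) \<le> g * card F"
proof -
  define U where "U = V - covered V E"
  define S where "S e = covered V (insert e E) - covered V E" for e
  define F1 where "F1 = {e \<in> F. S e \<noteq> {}}"
  define F2 where "F2 = {e \<in> F. S e = {}}"
  define U1 where "U1 = (\<Union>e\<in>F1. S e)"
  define U2 where "U2 = U - U1"
  note edgeD = simple_graph_edgeD[OF G]
  have FN: "F \<subseteq> non_edges V E" and cov: "covered V (E \<union> F) = V"
    using F by (auto simp: completion_set_def triangle_covered_iff)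
  have finV: "finite V"
    using G by (rule simple_graph_finite)
  then have fin: "finite F" "finite F1" "finite F2" "finite U" "finite U2"
    using FN finite_non_edges[OF finV, of E]
    by (auto simp: F1_def F2_def U_def U2_def intro: finite_subset)
  have finS: "finite (S e)" for e
    using finV covered_subset[of V "insert e E"] by (auto simp: S_def intro: finite_subset)
  have EF: "simple_graph V (E \<union> F)"
    using simple_graph_Un_non_edges[OF G FN] .
  have S_iff: "v \<in> S e \<longleftrightarrow> v \<in> U \<and>
      (\<exists>a b. {v, a} \<in> insert e E \<and> {v, b} \<in> insert e E \<and> {a, b} \<in> insert e E)"
    if "e \<in> F" for v e
  proof -
    have "simple_graph V (insert e E)"
      using simple_graph_insert_non_edge[OF G] that FN by blast
    from covered_iff[OF this, of v] covered_subset[of V "insert e E"] show ?thesis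
      by (auto simp: S_def U_def)
  qed
  have not_tri: "\<not> ({v, a} \<in> E \<and> {v, b} \<in> E \<and> {a, b} \<in> E)" if "v \<in> U" for v a b
    using that covered_iff[OF G, of v] by (auto simp: U_def)
  have U2_S: "v \<notin> S e" if "v \<in> U2" "e \<in> F" for v e
    using that by (auto simp: U2_def U1_def F1_def)

  have card_S: "card (S e) \<le> g" if "e \<in> non_edges V E" for e
    using g[OF that] by (simp add: gain_def S_def)
  have "card U1 \<le> (\<Sum>e\<in>F1. card (S e))"
    unfolding U1_def using fin(2) by (rule card_UN_le)
  also have "\<dots> \<le> (\<Sum>e\<in>F1. g)"
    using card_S FN by (intro sum_mono) (auto simp: F1_def)
  finally have U1: "card U1 \<le> g * card F1"
    by (simp add: mult.commute)

  \<comment> \<open>A useful edge is a side of the triangle that it closes, so both of its ends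
    become covered. An end in \<open>U2\<close> would then lie in \<open>S e\<close>.\<close>
  have F2I: "e \<in> F2" if v: "v \<in> U2" and e: "e \<in> F" "v \<in> e" for v e
  proof (rule ccontr)
    assume "e \<notin> F2"
    then obtain u where u: "u \<in> S e"
      using e by (auto simp: F2_def)
    then obtain a b where tri: "{u, a} \<in> insert e E" "{u, b} \<in> insert e E" "{a, b} \<in> insert e E"
      using S_iff[OF e(1)] by auto
    moreover have "e = {u, a} \<or> e = {u, b} \<or> e = {a, b}"
      using tri u not_tri[of u a b] S_iff[OF e(1)] by auto
    then have "v \<in> {u, a, b}"
      using e(2) by auto
    moreover have "v \<in> U"
      using v by (simp add: U2_def)
    moreover have "\<exists>x y. {v, x} \<in> insert e E \<and> {v, y} \<in> insert e E \<and> {x, y} \<in> insert e E"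
      using tri \<open>v \<in> {u, a, b}\<close> by (rule triangle_at_vertex)
    ultimately have "v \<in> S e"
      using S_iff[OF e(1), of v] by simp
    with U2_S[OF v e(1)] show False ..
  qed
  have U2_cases: "(\<exists>a b. a \<noteq> b \<and> {v, a} \<in> F2 \<and> {v, b} \<in> F2) \<or>
      (\<exists>a b. {v, a} \<in> E \<and> {v, b} \<in> F2 \<and> {a, b} \<in> F)" if v: "v \<in> U2" for v
  proof -
    have vU: "v \<in> U"
      using v by (simp add: U2_def)
    then have "v \<in> covered V (E \<union> F)"
      using cov by (auto simp: U_def)
    then obtain a b where ab: "{v, a} \<in> E \<union> F" "{v, b} \<in> E \<union> F" "{a, b} \<in> E \<union> F"
      using covered_iff[OF EF] by metis
    \<comment> \<open>No single edge of \<open>F\<close> closes the triangle \<open>v\<close>,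
      \<open>a\<close>, \<open>b\<close>, as \<open>v\<close> would otherwise lie in
      \<open>U1\<close>. So at least two of its sides are in \<open>F\<close>, one of them at
      \<open>v\<close>.\<close>
    have one: "\<not> ({x, y} \<in> F \<and> {v, a} \<in> insert {x, y} E \<and> {v, b} \<in> insert {x, y} E \<and>
        {a, b} \<in> insert {x, y} E)" for x y
      using U2_S[OF v, of "{x, y}"] S_iff[of "{x, y}" v] vU by blast
    have ne: "a \<noteq> b"
      using simple_graph_edgeD(3)[OF EF ab(3)] .
    consider "{v, a} \<in> F" "{v, b} \<in> F" | "{v, a} \<in> E" "{v, b} \<in> F" "{a, b} \<in> F"
      | "{v, b} \<in> E" "{v, a} \<in> F" "{a, b} \<in> F"
      using ab one[of v a] one[of v b] one[of a b] not_tri[OF vU, of a b] by blast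
    then show ?thesis
    proof cases
      case 3
      with F2I[OF v, of "{v, a}"] have "{v, b} \<in> E" "{v, a} \<in> F2" "{b, a} \<in> F"
        by (auto simp: insert_commute)
      then show ?thesis
        by blast
    qed (use ne F2I[OF v] in blast)+
  qed
  have edge_F2: "card e = 2" if "e \<in> F2" for e
    using that FN by (auto simp: F2_def non_edges_def)
  have U2: "card U2 \<le> g * card F2"
  proof (cases "g \<ge> 2")
    case True
    have "U2 \<subseteq> \<Union>F2"
      using U2_cases by blast
    moreover have "finite (\<Union>F2)"
      using fin(3) edge_F2 by (intro finite_Union) (auto intro: card_ge_0_finite)
    ultimately have "card U2 \<le> card (\<Union>F2)"
      by (metis card_mono)
    also have "\<dots> \<le> (\<Sum>e\<in>F2. card e)"
      using card_UN_le[OF fin(3), of id] by simp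
    also have "\<dots> = 2 * card F2"
      using edge_F2 by simp
    also have "\<dots> \<le> g * card F2"
      using True by simp
    finally show ?thesis .
  next
    case False
    show ?thesis
    proof (cases "U2 = {}")
      case nonempty: False
      then have "\<exists>e\<in>non_edges V E. gain V E e > 0"
        using gain_pos[OF G L] by (auto simp: U2_def U_def)
      with g have "g = 1"
        using False by fastforce
      \<comment> \<open>an edge inside \<open>U\<close> would lie on a path whose closing edge has gain at least two\<close>
      have outside: "a \<notin> U" if v: "v \<in> U" and va: "{v, a} \<in> E" for v a
      proof
        assume a: "a \<in> U"
        from v have "v \<in> V - covered V E"
          by (simp add: U_def)
        from edge_closing_path[OF G L this va] obtain e
          where e: "e \<in> non_edges V E" "v \<in> covered V (insert e E)" "a \<in> covered V (insert e E)" .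
        with a v have "{v, a} \<subseteq> S e"
          by (auto simp: S_def U_def)
        from card_mono[OF finS this] edgeD(3)[OF va] have "2 \<le> card (S e)"
          by simp
        with card_S[OF e(1)] \<open>g = 1\<close> show False
          by simp
      qed
      \<comment> \<open>The triangle at \<open>v\<close> meets the hypothesis of the charging lemma:
        a neighbour \<open>a\<close> of \<open>v\<close> in the graph lies outside \<open>U\<close>,
        and an edge of \<open>F\<close> at a vertex \<open>b\<close> of \<open>U2\<close> is
        useless.\<close>
      have "card U2 \<le> card F2"
      proof (rule card_le_card_edges[OF fin(5,3) edge_F2])
        fix v assume v: "v \<in> U2"
        show "(\<exists>a b. a \<noteq> b \<and> {v, a} \<in> F2 \<and> {v, b} \<in> F2) \<or>
            (\<exists>a b. {v, b} \<in> F2 \<and> a \<notin> U2 \<and> (b \<in> U2 \<longrightarrow> {a, b} \<in> F2))"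
          using U2_cases[OF v]
        proof (elim disjE exE conjE)
          fix a b assume ab: "{v, a} \<in> E" "{v, b} \<in> F2" "{a, b} \<in> F"
          have "a \<notin> U2"
            using outside[OF _ ab(1)] v by (auto simp: U2_def)
          moreover have "b \<in> U2 \<longrightarrow> {a, b} \<in> F2"
            using F2I[OF _ ab(3), of b] by simp
          ultimately show ?thesis
            using ab by blast
        qed blast
      qed
      with \<open>g = 1\<close> show ?thesis
        by simp
    qed simp
  qed
  have "U1 \<subseteq> U"
    by (auto simp: U1_def F1_def S_iff)
  then have "card U = card U1 + card U2"
    unfolding U2_def using fin(4) by (simp add: card_Diff_subset card_mono finite_subset)
  moreover have "card F = card F1 + card F2"
  proof -
    have "F = F1 \<union> F2" "F1 \<inter> F2 = {}"
      by (auto simp: F1_def F2_def)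
    then show ?thesis
      using fin by (simp add: card_Un_disjoint)
  qed
  ultimately show ?thesis
    using U1 U2 by (simp add: U_def algebra_simps)
qed

text \<open>All non-edges together make the graph complete, and every vertex has two others for a
  triangle. Hence the minimum in \<open>min_completion\<close> is attained.\<close>

lemma large_components_completion:
  assumes G: "simple_graph V E" and L: "large_components V E"
  shows "completion_set V E (non_edges V E)"
proof -
  have G': "simple_graph V (E \<union> non_edges V E)"
    using simple_graph_Un_non_edges[OF G order_refl] .
  have pair: "{x, y} \<in> E \<union> non_edges V E" if "x \<in> V" "y \<in> V" "x \<noteq> y" for x y
    using that by (auto simp: non_edges_doubleton)
  have "v \<in> covered V (E \<union> non_edges V E)" if v: "v \<in> V" for v
  proof -
    from L v obtain a b where ab: "b \<notin> {v, a}" "{v, a} \<in> E" "{v, b} \<in> E \<or> {a, b} \<in> E"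
      by (auto simp: large_components_def)
    then have "a \<in> V" "a \<noteq> v" "b \<in> V"
      using simple_graph_edgeD[OF G] by blast+
    then show ?thesis
      unfolding covered_iff[OF G'] using ab(1) v pair by (metis insertCI)
  qed
  then show ?thesis
    using covered_subset[of V "E \<union> non_edges V E"] by (auto simp: completion_set_def triangle_covered_iff)
qed

section \<open>Greedy steps, potential and invariant\<close>

definition uncovered :: "'a set \<Rightarrow> 'a set set \<Rightarrow> nat" where
  "uncovered V E = card (V - covered V E)"

text \<open>Phrased by the counts that the program compares. \<open>F' = F\<close> describes a round
  without improvement; the first conjunct then forces every gain to be zero.\<close>

definition greedy_step :: "'a set \<Rightarrow> 'a set set \<Rightarrow> 'a set set \<Rightarrow> 'a set set \<Rightarrow> bool" where
  "greedy_step V E F F' \<longleftrightarrow>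
     (\<forall>e\<in>non_edges V (E \<union> F). card (covered V (insert e (E \<union> F))) \<le> card (covered V (E \<union> F'))) \<and>
     (F' = F \<or> (\<exists>e\<in>non_edges V (E \<union> F). F' = insert e F \<and>
        card (covered V (E \<union> F)) < card (covered V (E \<union> F'))))"

text \<open>The logarithm replaces the harmonic numbers in the analysis of greedy set cover.\<close>

definition potential :: "nat \<Rightarrow> real" where
  "potential u = (if u = 0 then 0 else ln (real u) + 1)"

lemma potential_le: "potential u \<le> ln (real n) + 1" if "u \<le> n"
proof (cases "n = 0")
  case False
  then show ?thesis
    using that by (auto simp: potential_def intro!: add_nonneg_nonneg ln_ge_zero)
\<comment> \<open>For \<open>n = 0\<close> the right-hand side is 1, by the default value
  \<open>ln 0 = 0\<close>.\<close>
qed (use that in \<open>simp add: potential_def\<close>)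

text \<open>One edge of gain \<open>g\<close> is paid for by the drop of
  \<open>d * potential\<close>. For \<open>g < u\<close>, the bound \<open>ln x \<le> x - 1\<close>
  gives a drop of at least \<open>g / u \<ge> 1 / d\<close> in the logarithm; for
  \<open>g = u\<close>, the jump of \<open>potential\<close> at zero pays.\<close>

lemma potential_step:
  assumes "0 < g" "g \<le> u" "u \<le> g * d"
  shows "1 + real d * potential (u - g) \<le> real d * potential u"
proof (cases "u = g")
  case True
  then have "d \<ge> 1" "u \<ge> 1"
    using assms by auto
  then have "1 * 1 \<le> real d * (ln (real u) + 1)"
    by (intro mult_mono) auto
  with True show ?thesis
    using \<open>u \<ge> 1\<close> by (simp add: potential_def)
next
  case False
  then have ug: "u > g"
    using assms by simp
  have "ln (real (u - g) / real u) \<le> real (u - g) / real u - 1"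
    using ug by (intro ln_le_minus_one) auto
  also have "\<dots> = - (real g / real u)"
    using ug by (simp add: field_simps of_nat_diff)
  finally have "real g / real u \<le> ln (real u) - ln (real (u - g))"
    using ug by (simp add: ln_div)
  then have "real d * (real g / real u) \<le> real d * (ln (real u) - ln (real (u - g)))"
    by (intro mult_left_mono) auto
  moreover have "real u \<le> real d * real g"
    using assms(3) by (metis mult.commute of_nat_le_iff of_nat_mult)
  then have "1 \<le> real d * (real g / real u)"
    using ug by (simp add: field_simps)
  ultimately have "1 \<le> real d * (ln (real u) - ln (real (u - g)))"
    by linarith
  then show ?thesis
    using ug by (simp add: potential_def algebra_simps)
qed

lemma card_covered:
  assumes "finite V"
  shows "card (covered V E) + uncovered V E = card V"
  using assms covered_subset[of V E] unfolding uncovered_def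
  by (simp add: card_Diff_subset card_mono finite_subset)

lemma gain_eq:
  assumes "finite V"
  shows "card (covered V (insert e E)) = card (covered V E) + gain V E e"
proof -
  have "covered V E \<subseteq> covered V (insert e E)"
    by (intro covered_mono) auto
  moreover have "finite (covered V (insert e E))"
    using assms covered_subset by (rule finite_subset[rotated])
  ultimately show ?thesis
    by (simp add: gain_def card_Diff_subset card_mono finite_subset)
qed

text \<open>The second conjunct makes \<open>card V\<close> rounds suffice: each round covers a new
  vertex until none is left. The third says that the edges spent plus the remaining potential stay
  within the initial budget.\<close>

definition greedy_invariant :: "'a set \<Rightarrow> 'a set set \<Rightarrow> nat \<Rightarrow> 'a set set \<Rightarrow> bool" where
  "greedy_invariant V E i F \<longleftrightarrow> F \<subseteq> non_edges V E \<and>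
     (uncovered V (E \<union> F) = 0 \<or> uncovered V (E \<union> F) + i \<le> card V) \<and>
     real (card F) + real (min_completion V E) * potential (uncovered V (E \<union> F))
       \<le> real (min_completion V E) * (ln (real (card V)) + 1)"

lemma greedy_invariant_init:
  assumes "finite V"
  shows "greedy_invariant V E 0 {}"
proof -
  have "uncovered V E \<le> card V"
    using card_covered[OF assms, of E] by simp
  then show ?thesis
    using potential_le by (auto simp: greedy_invariant_def intro!: mult_left_mono)
qed

text \<open>An optimal completion \<open>H\<close> of the original graph, less the edges of
  \<open>F\<close>, completes the current graph \<open>D\<close>. So \<open>potential_step\<close>
  applies in every round with the original optimum as \<open>d\<close>.\<close>

lemma greedy_invariant_step:
  assumes G: "simple_graph V E" and L: "large_components V E"
    and I: "greedy_invariant V E i F" and step: "greedy_step V E F F'"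
  shows "greedy_invariant V E (Suc i) F'"
proof -
  define D where "D = E \<union> F"
  have finV: "finite V"
    using G by (rule simple_graph_finite)
  have FN: "F \<subseteq> non_edges V E"
    using I by (simp add: greedy_invariant_def)
  have GD: "simple_graph V D"
    unfolding D_def using simple_graph_Un_non_edges[OF G FN] .
  have LD: "large_components V D"
    using L by (rule large_components_mono) (simp add: D_def)
  note sum = card_covered[OF finV]
  show ?thesis
  proof (cases "F' = F")
    case True
    \<comment> \<open>A round that changes nothing leaves no non-edge of positive gain, which
      \<open>gain_pos\<close> excludes while a vertex is uncovered.\<close>
    have "uncovered V D = 0"
    proof (rule ccontr)
      assume "\<not> ?thesis"
      then obtain v where "v \<in> V - covered V D"
        by (metis all_not_in_conv card.empty uncovered_def)
      from gain_pos[OF GD LD this] step True show False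
        by (auto simp: greedy_step_def gain_eq[OF finV] D_def)
    qed
    with I True show ?thesis
      by (simp add: greedy_invariant_def D_def)
  next
    case False
    with step obtain e where e: "e \<in> non_edges V D" "F' = insert e F"
      by (auto simp: greedy_step_def D_def)
    have EF': "E \<union> F' = insert e D"
      using e by (auto simp: D_def)
    have less: "card (covered V D) < card (covered V (insert e D))"
      and max: "\<And>e'. e' \<in> non_edges V D \<Longrightarrow>
        card (covered V (insert e' D)) \<le> card (covered V (insert e D))"
      using step False unfolding greedy_step_def EF' by (auto simp: D_def)
    define g where "g = gain V D e"
    have u': "uncovered V (insert e D) = uncovered V D - g" "g \<le> uncovered V D"
      using sum[of D] sum[of "insert e D"] gain_eq[OF finV, of e D] by (auto simp: g_def)
    have g0: "0 < g"
      using less by (simp add: gain_eq[OF finV] g_def)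
    have F'N: "F' \<subseteq> non_edges V E"
      using e FN by (auto simp: non_edges_def D_def)
    have "e \<notin> F"
      using e(1) by (auto simp: non_edges_def D_def)
    moreover have "finite F"
      using FN finite_non_edges[OF finV] by (rule finite_subset)
    ultimately have card_F': "card F' = Suc (card F)"
      using e(2) by simp
    have "\<exists>k. \<exists>H. completion_set V E H \<and> card H = k"
      using large_components_completion[OF G L] by blast
    then obtain H where H: "completion_set V E H" "card H = min_completion V E"
      unfolding min_completion_def by (rule LeastI_ex[THEN exE]) blast
    have "covered V (E \<union> H) \<subseteq> covered V (D \<union> (H - F))"
      by (rule covered_mono) (auto simp: D_def)
    then have "completion_set V D (H - F)"
      using H(1) covered_subset[of V "D \<union> (H - F)"]
      by (auto simp: completion_set_def triangle_covered_iff non_edges_def D_def)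
    from card_uncovered_le[OF GD LD this, of g] max
    have "uncovered V D \<le> g * card (H - F)"
      by (simp add: gain_eq[OF finV] g_def uncovered_def)
    also have "card (H - F) \<le> card H"
      using H(1) finite_non_edges[OF finV, of E]
      by (intro card_mono) (auto simp: completion_set_def intro: finite_subset)
    finally have "uncovered V D \<le> g * min_completion V E"
      using H(2) by simp
    from potential_step[OF g0 u'(2) this]
    have "real (card F') + real (min_completion V E) * potential (uncovered V (insert e D))
        \<le> real (card F) + real (min_completion V E) * potential (uncovered V D)"
      by (simp add: card_F' u'(1))
    moreover have "uncovered V (insert e D) = 0 \<or> uncovered V (insert e D) + Suc i \<le> card V"
      using I u' g0 by (auto simp: greedy_invariant_def D_def)
    ultimately show ?thesis
      using I F'N by (simp add: greedy_invariant_def EF') (simp add: D_def)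
  qed
qed

lemma greedy_invariant_final:
  assumes "finite V" "greedy_invariant V E (card V) F"
  shows "completion_set V E F"
    and "real (card F) \<le> (ln (real (card V)) + 1) * real (min_completion V E)"
proof -
  \<comment> \<open>With \<open>i = card V\<close>, the second alternative of the invariant also
    forces zero.\<close>
  have u: "uncovered V (E \<union> F) = 0"
    using assms(2) by (auto simp: greedy_invariant_def)
  then have "V - covered V (E \<union> F) = {}"
    using assms(1) by (simp add: uncovered_def)
  then show "completion_set V E F"
    using assms(2) covered_subset[of V "E \<union> F"]
    by (auto simp: greedy_invariant_def completion_set_def triangle_covered_iff)
  show "real (card F) \<le> (ln (real (card V)) + 1) * real (min_completion V E)"
    using assms(2) u by (simp add: greedy_invariant_def potential_def mult.commute)
qed

section \<open>Programs with bounded loops\<close>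

primrec assigned :: "com \<Rightarrow> nat set" where
  "assigned Skip = {}"
| "assigned (Assign x e) = {x}"
| "assigned (Store a e) = {}"
| "assigned (Seq c d) = assigned c \<union> assigned d"
| "assigned (If e c d) = assigned c \<union> assigned d"
| "assigned (While e c) = assigned c"

primrec store_free :: "com \<Rightarrow> bool" where
  "store_free Skip \<longleftrightarrow> True"
| "store_free (Assign x e) \<longleftrightarrow> True"
| "store_free (Store a e) \<longleftrightarrow> False"
| "store_free (Seq c d) \<longleftrightarrow> store_free c \<and> store_free d"
| "store_free (If e c d) \<longleftrightarrow> store_free c \<and> store_free d"
| "store_free (While e c) \<longleftrightarrow> store_free c"

lemma exec_not_assigned:
  "exec c s t s' \<Longrightarrow> x \<notin> assigned c \<Longrightarrow> fst s' x = fst s x"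
  by (induction rule: exec.induct) auto

lemma exec_store_free: "exec c s t s' \<Longrightarrow> store_free c \<Longrightarrow> snd s' = snd s"
  by (induction rule: exec.induct) auto

text \<open>Next to its counter in register \<open>k\<close>, a loop maintains \<open>n\<close> times the counter in register
  \<open>k + 1\<close>, so that matrix rows can be addressed without multiplication.\<close>

definition advance :: "nat \<Rightarrow> com" where
  "advance k = Seq (Assign k (Plus (Reg k) (Const 1)))
     (Assign (Suc k) (Plus (Reg (Suc k)) (Reg 0)))"

definition Loop :: "nat \<Rightarrow> com \<Rightarrow> com" where
  "Loop k c = Seq (Assign k (Const 0)) (Seq (Assign (Suc k) (Const 0))
     (While (Minus (Reg 0) (Reg k)) (Seq c (advance k))))"

lemma assigned_Loop [simp]: "assigned (Loop k c) = {k, Suc k} \<union> assigned c"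
  by (auto simp: Loop_def advance_def)

lemma store_free_Loop [simp]: "store_free (Loop k c) = store_free c"
  by (auto simp: Loop_def advance_def)

section \<open>Polynomial running time\<close>

text \<open>As long as register 0 is never assigned, it fixes the number of iterations of each such
  loop, so running time can be bounded by structural induction.\<close>

inductive bounded :: "com \<Rightarrow> bool" where
  "bounded Skip"
| "bounded (Assign x e)"
| "bounded (Store a e)"
| "bounded c \<Longrightarrow> bounded d \<Longrightarrow> bounded (Seq c d)"
| "bounded c \<Longrightarrow> bounded d \<Longrightarrow> bounded (If e c d)"
| "bounded c \<Longrightarrow> k \<noteq> 0 \<Longrightarrow> k \<notin> assigned c \<Longrightarrow> bounded (Loop k c)"

text \<open>One polynomial serves all initial states, whatever the memory holds, so bounds compose
  without knowledge of the intermediate states.\<close>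

definition polytime :: "com \<Rightarrow> bool" where
  "polytime c \<longleftrightarrow> (\<exists>p. \<forall>s. \<exists>t s'. exec c s t s' \<and> t \<le> poly p (fst s 0))"

lemma polytimeI:
  fixes p :: "nat poly"
  assumes "\<And>r m. \<exists>t s'. exec c (r, m) t s' \<and> t \<le> poly p (r 0)"
  shows "polytime c"
  unfolding polytime_def by (rule exI[of _ p]) (use assms in auto)

lemma polytime_Seq:
  assumes c: "polytime c" "0 \<notin> assigned c" and d: "polytime d"
  shows "polytime (Seq c d)"
proof -
  from c(1) d obtain p q where
    p: "\<And>s. \<exists>t s'. exec c s t s' \<and> t \<le> poly p (fst s 0)" and
    q: "\<And>s. \<exists>t s'. exec d s t s' \<and> t \<le> poly q (fst s 0)"
    unfolding polytime_def by metis
  have "\<exists>t s'. exec (Seq c d) s t s' \<and> t \<le> poly (p + q) (fst s 0)" for s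
  proof -
    obtain t s' where 1: "exec c s t s'" "t \<le> poly p (fst s 0)"
      using p by blast
    obtain u s'' where 2: "exec d s' u s''" "u \<le> poly q (fst s' 0)"
      using q by blast
    have "fst s' 0 = fst s 0"
      using exec_not_assigned[OF 1(1) c(2)] .
    with exec.Seq[OF 1(1) 2(1)] 1(2) 2(2) show ?thesis
      by (metis add_mono poly_add)
  qed
  then show ?thesis
    unfolding polytime_def by metis
qed

lemma polytime_If:
  assumes "polytime c" "polytime d"
  shows "polytime (If e c d)"
proof -
  from assms obtain p q where
    p: "\<And>s. \<exists>t s'. exec c s t s' \<and> t \<le> poly p (fst s 0)" and
    q: "\<And>s. \<exists>t s'. exec d s t s' \<and> t \<le> poly q (fst s 0)"
    unfolding polytime_def by metis
  have "\<exists>t s'. exec (If e c d) s t s' \<and> t \<le> poly (p + q + [:cost e + 1:]) (fst s 0)" for s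
  proof (cases "val e s = 0")
    case True
    obtain u s'' where "exec d s u s''" "u \<le> poly q (fst s 0)"
      using q by blast
    with exec.If_False[OF True this(1), of c] show ?thesis
      by (intro exI[of _ "cost e + u + 1"] exI[of _ s'']) auto
  next
    case False
    obtain u s'' where "exec c s u s''" "u \<le> poly p (fst s 0)"
      using p by blast
    with exec.If_True[OF False this(1), of d] show ?thesis
      by (intro exI[of _ "cost e + u + 1"] exI[of _ s'']) auto
  qed
  then show ?thesis
    unfolding polytime_def by metis
qed

lemma exec_Assign: "exec (Assign x e) s (cost e + 1) ((fst s)(x := val e s), snd s)"
  using exec.Assign[of x e "fst s" "snd s"] by simp

lemma exec_advance:
  "exec (advance k) (r, m) 8 (r(k := r k + 1, Suc k := r (Suc k) + r 0), m)" if "k \<noteq> 0"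
  using exec.Seq[OF exec_Assign[of k "Plus (Reg k) (Const 1)" "(r, m)"]
      exec_Assign[of "Suc k" "Plus (Reg (Suc k)) (Reg 0)"]] that
  by (simp add: advance_def eval_nat_numeral)

lemma polytime_Loop:
  assumes c: "polytime c" "0 \<notin> assigned c" "k \<notin> assigned c" and k: "k \<noteq> 0"
  shows "polytime (Loop k c)"
proof -
  let ?b = "Minus (Reg 0) (Reg k)"
  let ?W = "While ?b (Seq c (advance k))"
  obtain p where p: "\<And>s. \<exists>t s'. exec c s t s' \<and> t \<le> poly p (fst s 0)"
    using c(1) unfolding polytime_def by metis
  \<comment> \<open>\<open>j\<close> is the number of iterations left. The failing test costs 4; an
    iteration adds 4 for the test and 8 for \<open>advance\<close> to the cost of the body.\<close>
  have W: "\<exists>t s'. exec ?W s t s' \<and> t \<le> 4 + j * (poly p n + 12)"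
    if "fst s 0 = n" "fst s k + j = n" for s j n
    using that
  proof (induction j arbitrary: s)
    case 0
    have "exec ?W s (cost ?b + 1) s"
      by (rule exec.While_False) (use 0 in simp)
    then show ?case
      by fastforce
  next
    case (Suc j)
    obtain t s1 where 1: "exec c s t s1" "t \<le> poly p n"
      using p Suc.prems by blast
    obtain r m where rm: "s1 = (r, m)"
      by (cases s1)
    have r: "r 0 = n" "r k = fst s k"
      using exec_not_assigned[OF 1(1)] c Suc.prems rm by auto
    let ?s2 = "(r(k := r k + 1, Suc k := r (Suc k) + r 0), m)"
    have body: "exec (Seq c (advance k)) s (t + 8) ?s2"
      using exec.Seq[OF 1(1)] exec_advance[OF k, of r m] rm by simp
    obtain u s3 where 3: "exec ?W ?s2 u s3" "u \<le> 4 + j * (poly p n + 12)"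
      using Suc.IH[of ?s2] k r Suc.prems by auto
    have "exec ?W s (cost ?b + (t + 8) + u + 1) s3"
      by (rule exec.While_True[OF _ body 3(1)]) (use Suc.prems in simp)
    then show ?case
      using 1(2) 3(2) by (intro exI[of _ "cost ?b + (t + 8) + u + 1"] exI[of _ s3]) auto
  qed
  \<comment> \<open>The constant 8 is 4 for clearing two registers plus 4 for the final
    test.\<close>
  have "\<exists>t s'. exec (Loop k c) (r, m) t s' \<and> t \<le> poly ([:0, 1:] * (p + [:12:]) + [:8:]) (r 0)"
    for r m
  proof -
    obtain t s' where t: "exec ?W (r(k := 0, Suc k := 0), m) t s'" "t \<le> 4 + r 0 * (poly p (r 0) + 12)"
      using W[of "(r(k := 0, Suc k := 0), m)" "r 0" "r 0"] k by auto
    have "exec (Loop k c) (r, m) (4 + t) s'"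
      using exec.Seq[OF exec_Assign[of k "Const 0" "(r, m)"]
          exec.Seq[OF exec_Assign[of "Suc k" "Const 0"], where d = ?W and t' = t and s'' = s']] t(1)
      by (simp add: Loop_def eval_nat_numeral)
    then show ?thesis
      using t(2) by (intro exI[of _ "4 + t"] exI[of _ s']) (auto simp: algebra_simps)
  qed
  then show ?thesis
    by (rule polytimeI)
qed

lemma polytime_if_bounded: "bounded c \<Longrightarrow> 0 \<notin> assigned c \<Longrightarrow> polytime c"
proof (induction rule: bounded.induct)
  case 1
  have "exec Skip (r, m) 1 (r, m)" for r m
    by (rule exec.Skip)
  then show ?case
    by (intro polytimeI[where p = "[:1:]"]) fastforce
next
  case (2 x e)
  show ?case
    using exec.Assign by (intro polytimeI[where p = "[:cost e + 1:]"]) fastforce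
next
  case (3 a e)
  show ?case
    using exec.Store by (intro polytimeI[where p = "[:cost a + cost e + 1:]"]) fastforce
qed (simp_all add: polytime_Seq polytime_If polytime_Loop)

section \<open>Partial correctness\<close>

text \<open>Termination is left to \<open>polytime\<close>. As runs are deterministic,
  \<open>wlp\<close> of a loop-free command is computed by rewriting; loops are handled by
  invariants.\<close>

definition wlp :: "com \<Rightarrow> (state \<Rightarrow> bool) \<Rightarrow> state \<Rightarrow> bool" where
  "wlp c Q s \<longleftrightarrow> (\<forall>t s'. exec c s t s' \<longrightarrow> Q s')"

lemma wlp_mono: "wlp c P s \<Longrightarrow> (\<And>s'. P s' \<Longrightarrow> Q s') \<Longrightarrow> wlp c Q s"
  by (auto simp: wlp_def)

text \<open>Lets a specification mention only what changes; the rest of the state is recovered from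
  the syntax of \<open>c\<close>.\<close>

lemma wlp_frame:
  assumes "wlp c P s"
    and "\<And>s'. P s' \<Longrightarrow> (\<And>x. x \<notin> assigned c \<Longrightarrow> fst s' x = fst s x) \<Longrightarrow>
      (store_free c \<Longrightarrow> snd s' = snd s) \<Longrightarrow> Q s'"
  shows "wlp c Q s"
  using assms exec_not_assigned[of c s] exec_store_free[of c s] unfolding wlp_def by blast

lemma wlp_eq: "exec c s t s' \<Longrightarrow> wlp c Q s = Q s'"
  unfolding wlp_def using exec_deterministic by blast

lemma wlp_Skip [simp]: "wlp Skip Q s = Q s"
  using wlp_eq[OF exec.Skip] .

lemma wlp_Assign [simp]: "wlp (Assign x e) Q s = Q ((fst s)(x := val e s), snd s)"
  using wlp_eq[OF exec_Assign] .

lemma wlp_Store [simp]: "wlp (Store a e) Q s = Q (fst s, (snd s)(val a s := val e s))"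
  using wlp_eq[OF exec.Store[of a e "fst s" "snd s"]] by simp

lemma wlp_Seq [simp]: "wlp (Seq c d) Q s = wlp c (wlp d Q) s"
proof -
  have "(\<exists>t. exec (Seq c d) s t s'') \<longleftrightarrow> (\<exists>t s' u. exec c s t s' \<and> exec d s' u s'')" for s''
    by (blast intro: exec.Seq elim: exec.cases[of "Seq c d"])
  then show ?thesis
    unfolding wlp_def by blast
qed

lemma wlp_If [simp]: "wlp (If e c d) Q s = (if val e s \<noteq> 0 then wlp c Q s else wlp d Q s)"
proof (cases "val e s = 0")
  case True
  then have "(\<exists>t. exec (If e c d) s t s') \<longleftrightarrow> (\<exists>t. exec d s t s')" for s'
    by (auto intro: exec.If_False elim: exec.cases[of "If e c d"])
  then have "wlp (If e c d) Q s = wlp d Q s"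
    unfolding wlp_def by blast
  with True show ?thesis
    by simp
next
  case False
  then have "(\<exists>t. exec (If e c d) s t s') \<longleftrightarrow> (\<exists>t. exec c s t s')" for s'
    by (auto intro: exec.If_True elim: exec.cases[of "If e c d"])
  then have "wlp (If e c d) Q s = wlp c Q s"
    unfolding wlp_def by blast
  with False show ?thesis
    by simp
qed

lemma wlp_While:
  assumes "I s" and "\<And>s. I s \<Longrightarrow> val e s \<noteq> 0 \<Longrightarrow> wlp c I s"
    and "\<And>s. I s \<Longrightarrow> val e s = 0 \<Longrightarrow> Q s"
  shows "wlp (While e c) Q s"
proof -
  have "I s' \<and> val e s' = 0" if "exec (While e c) s t s'" "I s" for t s s'
    using that
  proof (induction "While e c" s t s' rule: exec.induct)
    case (While_True s t s' t' s'')
    then show ?case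
      using assms(2) unfolding wlp_def by blast
  qed auto
  with assms(1,3) show ?thesis
    by (auto simp: wlp_def)
qed

text \<open>In \<open>step\<close> the counter and row offset are already set to the values that
  \<open>advance\<close> will produce, so only the body has to be verified.\<close>

lemma wlp_Loop:
  assumes n: "fst s 0 = n" and k: "k \<noteq> 0" "0 \<notin> assigned c" "k \<notin> assigned c" "Suc k \<notin> assigned c"
    and init: "I 0 ((fst s)(k := 0, Suc k := 0), snd s)"
    and step: "\<And>i s. i < n \<Longrightarrow> I i s \<Longrightarrow> fst s 0 = n \<Longrightarrow> fst s k = i \<Longrightarrow> fst s (Suc k) = i * n \<Longrightarrow>
      wlp c (\<lambda>s'. I (Suc i) ((fst s')(k := Suc i, Suc k := Suc i * n), snd s')) s"
    and final: "\<And>s. I n s \<Longrightarrow> fst s 0 = n \<Longrightarrow> Q s"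
  shows "wlp (Loop k c) Q s"
proof -
  \<comment> \<open>The bound \<open>i \<le> n\<close> matters at exit: the failing test only says
    that the truncated difference \<open>n - i\<close> is zero, which then gives
    \<open>i = n\<close>.\<close>
  define J where "J s \<longleftrightarrow> (\<exists>i\<le>n. I i s \<and> fst s 0 = n \<and> fst s k = i \<and> fst s (Suc k) = i * n)" for s
  have "wlp (While (Minus (Reg 0) (Reg k)) (Seq c (advance k))) Q
      ((fst s)(k := 0, Suc k := 0), snd s)"
  proof (rule wlp_While[where I = J])
    show "J ((fst s)(k := 0, Suc k := 0), snd s)"
      using n k init by (auto simp: J_def)
  next
    fix s assume "J s" "val (Minus (Reg 0) (Reg k)) s \<noteq> 0"
    then obtain i where i: "i < n" "I i s" "fst s 0 = n" "fst s k = i" "fst s (Suc k) = i * n"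
      by (auto simp: J_def)
    from step[OF i] have "wlp c (wlp (advance k) J) s"
    proof (rule wlp_frame)
      fix s' assume I: "I (Suc i) ((fst s')(k := Suc i, Suc k := Suc i * n), snd s')"
        and frame: "\<And>x. x \<notin> assigned c \<Longrightarrow> fst s' x = fst s x"
      have "fst s' 0 = n" "fst s' k = i" "fst s' (Suc k) = i * n"
        using frame k i by auto
      then show "wlp (advance k) J s'"
        using I k(1) i(1) by (auto simp: advance_def J_def add.commute)
    qed
    then show "wlp (Seq c (advance k)) J s"
      by simp
  next
    fix s assume "J s" "val (Minus (Reg 0) (Reg k)) s = 0"
    then show "Q s"
      using final[of s] by (auto simp: J_def)
  qed
  then show ?thesis
    by (simp add: Loop_def)
qed

section \<open>The greedy program\<close>

lemma cell_eq_iff: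
  fixes x y x' y' n :: nat
  assumes "y < n" "y' < n"
  shows "x * n + y = x' * n + y' \<longleftrightarrow> x = x' \<and> y = y'"
proof
  assume "x * n + y = x' * n + y'"
  then have "(x * n + y) div n = (x' * n + y') div n" "(x * n + y) mod n = (x' * n + y') mod n"
    by simp_all
  then show "x = x' \<and> y = y'"
    using assms by simp
qed simp

lemma cell_less: "x * n + y < n * n" if "x < n" "y < n" for x y n :: nat
proof -
  have "x * n + y < Suc x * n"
    using that by simp
  also have "\<dots> \<le> n * n"
    using that by (intro mult_le_mono1) simp
  finally show ?thesis .
qed

text \<open>A cell is nonzero iff its pair is an edge of the current graph, while the marks 1 and 2
  keep input edges and added edges apart for the output.\<close>

definition represents :: "nat \<Rightarrow> nat set set \<Rightarrow> nat set set \<Rightarrow> (nat \<Rightarrow> nat) \<Rightarrow> bool" where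
  "represents n E F m \<longleftrightarrow> (\<forall>x<n. \<forall>y<n. m (x * n + y) =
     (if {x, y} \<in> E then 1 else if {x, y} \<in> F then 2 else 0))"

definition mem_covered :: "nat \<Rightarrow> (nat \<Rightarrow> nat) \<Rightarrow> nat \<Rightarrow> bool" where
  "mem_covered n m v \<longleftrightarrow> (\<exists>a<n. \<exists>b<n.
     m (v * n + a) \<noteq> 0 \<and> m (v * n + b) \<noteq> 0 \<and> m (a * n + b) \<noteq> 0)"

lemma card_mem_covered:
  assumes G: "simple_graph {..<n} (E \<union> F)" and m: "represents n E F m"
  shows "card {v. v < n \<and> mem_covered n m v} = card (covered {..<n} (E \<union> F))"
proof -
  have nz: "m (x * n + y) \<noteq> 0 \<longleftrightarrow> {x, y} \<in> E \<union> F" if "x < n" "y < n" for x y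
    using m that by (auto simp: represents_def)
  \<comment> \<open>Ends of edges are vertices, so searching only below \<open>n\<close> loses
    nothing.\<close>
  have "v < n \<and> mem_covered n m v \<longleftrightarrow> v \<in> covered {..<n} (E \<union> F)" for v
    unfolding covered_iff[OF G] mem_covered_def
    using simple_graph_edgeD(1,2)[OF G] nz by (metis lessThan_iff)
  then show ?thesis
    by (metis (no_types, lifting) Collect_cong Collect_mem_eq)
qed

lemma if_disj: "(if P then c else if Q then c else d) = (if Q \<or> P then c else d)"
  by simp

lemma represents_insert:
  assumes m: "represents n E F m" and xy: "x < n" "y < n" "{x, y} \<notin> E"
  shows "represents n E (insert {x, y} F) (m(x * n + y := 2, y * n + x := 2))"
  unfolding represents_def
proof (intro allI impI)
  fix u v assume uv: "u < n" "v < n"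
  have "{u, v} = {x, y} \<longleftrightarrow> u * n + v = x * n + y \<or> u * n + v = y * n + x"
    unfolding cell_eq_iff[OF uv(2) xy(2)] cell_eq_iff[OF uv(2) xy(1)] by (rule doubleton_eq_iff)
  then have "(m(x * n + y := 2, y * n + x := 2)) (u * n + v) =
      (if {u, v} = {x, y} then 2 else m (u * n + v))"
    by (simp only: fun_upd_apply if_disj)
  then show "(m(x * n + y := 2, y * n + x := 2)) (u * n + v) =
      (if {u, v} \<in> E then 1 else if {u, v} \<in> insert {x, y} F then 2 else 0)"
    using m uv xy by (simp add: represents_def)
qed

text \<open>Register 0 holds \<open>n\<close>, the loops run on registers 2, 4, 6, 8, 10, 12 (each followed by its
  row offset), and the scratch registers are 14 (number of covered vertices), 15 (whether the
  current vertex is covered), 16 (best count so far), 17 and 18 (the cells of the pair attaining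
  it). Edges added to the input are stored as 2.\<close>

definition cell :: "nat \<Rightarrow> nat \<Rightarrow> exp" where
  "cell x y = Plus (Reg (Suc x)) (Reg y)"

definition count_covered :: com where
  "count_covered = Seq (Assign 14 (Const 0)) (Loop 8 (Seq (Assign 15 (Const 0)) (Seq
     (Loop 10 (Loop 12
       (If (Mem (cell 8 10)) (If (Mem (cell 8 12)) (If (Mem (cell 10 12))
         (Assign 15 (Const 1)) Skip) Skip) Skip)))
     (Assign 14 (Plus (Reg 14) (Reg 15))))))"

definition write_pair :: "nat \<Rightarrow> com" where
  "write_pair k = Seq (Store (cell 4 6) (Const k)) (Store (cell 6 4) (Const k))"

text \<open>Trial insertion of a non-edge. The difference of the counters is nonzero iff
  \<open>x < y\<close>, which selects one orientation of each pair; writing 0 undoes the trial, and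
  only a strict improvement is recorded.\<close>

definition probe :: com where
  "probe = If (Mem (cell 4 6)) Skip (If (Minus (Reg 6) (Reg 4))
     (Seq (write_pair 2) (Seq count_covered (Seq (write_pair 0)
       (If (Minus (Reg 14) (Reg 16))
         (Seq (Assign 16 (Reg 14)) (Seq (Assign 17 (cell 4 6)) (Assign 18 (cell 6 4))))
         Skip))))
     Skip)"

text \<open>A pair \<open>x < y\<close> found by probing has the nonzero cell \<open>y * n + x\<close>, so register 18 also tells
  whether there is an improvement.\<close>

definition greedy_round :: com where
  "greedy_round = Seq count_covered (Seq (Assign 16 (Reg 14)) (Seq (Assign 18 (Const 0)) (Seq
     (Loop 4 (Loop 6 probe))
     (If (Reg 18) (Seq (Store (Reg 17) (Const 2)) (Store (Reg 18) (Const 2))) Skip))))"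

text \<open>The final truncated decrement erases the input edges and turns the mark 2 of added edges
  into 1.\<close>

definition greedy_completion :: com where
  "greedy_completion = Seq (Loop 2 greedy_round)
     (Loop 4 (Loop 6 (Store (cell 4 6) (Minus (Mem (cell 4 6)) (Const 1)))))"

lemma assigned_count_covered [simp]: "assigned count_covered = {8..15}"
  by (auto simp: count_covered_def)

lemma store_free_count_covered [simp]: "store_free count_covered"
  by (simp add: count_covered_def)

lemma assigned_probe [simp]: "assigned probe = {8..18}"
  by (auto simp: probe_def write_pair_def)

lemma assigned_greedy_round [simp]: "assigned greedy_round = {4..18}"
  by (auto simp: greedy_round_def)

lemma polytime_greedy_completion: "polytime greedy_completion"
proof (rule polytime_if_bounded)
  have "bounded count_covered"
    unfolding count_covered_def by (intro bounded.intros) auto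
  moreover from this have "bounded probe"
    unfolding probe_def write_pair_def by (intro bounded.intros)
  ultimately have "bounded greedy_round"
    unfolding greedy_round_def by (intro bounded.intros) auto
  then show "bounded greedy_completion"
    unfolding greedy_completion_def by (intro bounded.intros) auto
  show "0 \<notin> assigned greedy_completion"
    by (simp add: greedy_completion_def)
qed

section \<open>Correctness of the program\<close>

lemma ex_less_Suc: "(\<exists>i<Suc k. P i) \<longleftrightarrow> (\<exists>i<k. P i) \<or> P k"
  by (auto simp: less_Suc_eq)

lemma card_less_Suc:
  "card {v. v < Suc k \<and> P v} = card {v. v < k \<and> P v} + (if P k then 1 else 0)"
proof -
  have "{v. v < Suc k \<and> P v} = (if P k then insert k {v. v < k \<and> P v} else {v. v < k \<and> P v})"
    by (auto simp: less_Suc_eq)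
  then show ?thesis
    by simp
qed

lemma wlp_count_covered:
  assumes n: "fst s 0 = n"
  shows "wlp count_covered (\<lambda>s'. fst s' 14 = card {v. v < n \<and> mem_covered n (snd s) v}) s"
proof -
  define m where "m = snd s"
  define T where "T v a b \<longleftrightarrow> m (v * n + a) \<noteq> 0 \<and> m (v * n + b) \<noteq> 0 \<and> m (a * n + b) \<noteq> 0" for v a b
  have T: "mem_covered n m v \<longleftrightarrow> (\<exists>a<n. \<exists>b<n. T v a b)" for v
    by (simp add: mem_covered_def T_def)
  define K where "K i = card {v. v < i \<and> mem_covered n m v}" for i
  define I where "I i s' \<longleftrightarrow> fst s' 14 = K i \<and> snd s' = m" for i and s' :: state
  show ?thesis
    unfolding count_covered_def wlp_Seq wlp_Assign
  proof (rule wlp_Loop[where I = I])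
    fix i s' assume i: "i < n" "I i s'" "fst s' 0 = n" "fst s' 8 = i" "fst s' (Suc 8) = i * n"
    \<comment> \<open>Register 15 tells whether a triangle at \<open>i\<close> was found among the
      pairs before \<open>(j, k)\<close> in lexicographic order. \<open>J n j\<close> thus amounts
      to the outer invariant \<open>J 0 (Suc j)\<close>.\<close>
    define J where "J k j s' \<longleftrightarrow> fst s' 14 = K i \<and> snd s' = m \<and> fst s' 8 = i \<and> fst s' 9 = i * n \<and>
      fst s' 15 = (if (\<exists>a<j. \<exists>b<n. T i a b) \<or> (\<exists>b<k. T i j b) then 1 else 0)"
      for k j and s' :: state
    show "wlp (Seq (Assign 15 (Const 0)) (Seq
       (Loop 10 (Loop 12
         (If (Mem (cell 8 10)) (If (Mem (cell 8 12)) (If (Mem (cell 10 12))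
           (Assign 15 (Const 1)) Skip) Skip) Skip)))
       (Assign 14 (Plus (Reg 14) (Reg 15)))))
       (\<lambda>s''. I (Suc i) ((fst s'')(8 := Suc i, Suc 8 := Suc i * n), snd s'')) s'"
      unfolding wlp_Seq wlp_Assign
    proof (rule wlp_Loop[where I = "J 0"])
      fix j s1 assume j: "j < n" "J 0 j s1" "fst s1 0 = n" "fst s1 10 = j" "fst s1 (Suc 10) = j * n"
      show "wlp (Loop 12 (If (Mem (cell 8 10)) (If (Mem (cell 8 12)) (If (Mem (cell 10 12))
           (Assign 15 (Const 1)) Skip) Skip) Skip))
         (\<lambda>s''. J 0 (Suc j) ((fst s'')(10 := Suc j, Suc 10 := Suc j * n), snd s'')) s1"
      proof (rule wlp_Loop[where I = "\<lambda>k s''. J k j s'' \<and> fst s'' 10 = j \<and> fst s'' 11 = j * n"])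
        fix k s2 assume "k < n" "J k j s2 \<and> fst s2 10 = j \<and> fst s2 11 = j * n"
          "fst s2 0 = n" "fst s2 12 = k" "fst s2 (Suc 12) = k * n"
        then show "wlp (If (Mem (cell 8 10)) (If (Mem (cell 8 12)) (If (Mem (cell 10 12))
            (Assign 15 (Const 1)) Skip) Skip) Skip)
          (\<lambda>s''. J (Suc k) j ((fst s'')(12 := Suc k, Suc 12 := Suc k * n),
             snd s'') \<and> fst ((fst s'')(12 := Suc k, Suc 12 := Suc k * n), snd s'') 10 = j \<and>
             fst ((fst s'')(12 := Suc k, Suc 12 := Suc k * n), snd s'') 11 = j * n) s2"
          by (simp add: J_def cell_def T_def ex_less_Suc)
      qed (use j in \<open>auto simp: J_def ex_less_Suc\<close>)
    next
      fix s1 assume "J 0 n s1"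
      then show "I (Suc i) ((fst ((fst s1)(14 := val (Plus (Reg 14) (Reg 15)) s1), snd s1))
          (8 := Suc i, Suc 8 := Suc i * n), snd ((fst s1)(14 := val (Plus (Reg 14) (Reg 15)) s1), snd s1))"
        by (simp add: J_def I_def K_def card_less_Suc T)
    qed (use i in \<open>auto simp: J_def I_def\<close>)
  qed (use n in \<open>auto simp: I_def K_def m_def\<close>)
qed

text \<open>\<open>S\<close> is the set of pairs probed so far.\<close>

definition probed :: "nat \<Rightarrow> nat set set \<Rightarrow> (nat \<Rightarrow> nat) \<Rightarrow> (nat \<times> nat) set \<Rightarrow> state \<Rightarrow> bool" where
  "probed n D m S s \<longleftrightarrow> snd s = m \<and> card (covered {..<n} D) \<le> fst s 16 \<and>
     (\<forall>x y. (x, y) \<in> S \<longrightarrow> x < y \<longrightarrow> y < n \<longrightarrow> {x, y} \<notin> D \<longrightarrow>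
       card (covered {..<n} (insert {x, y} D)) \<le> fst s 16) \<and>
     (if fst s 18 = 0 then fst s 16 = card (covered {..<n} D)
      else \<exists>x y. x < y \<and> y < n \<and> {x, y} \<notin> D \<and> fst s 17 = x * n + y \<and> fst s 18 = y * n + x \<and>
        fst s 16 = card (covered {..<n} (insert {x, y} D)) \<and>
        card (covered {..<n} D) < fst s 16)"

lemma probed_cong:
  assumes "probed n D m S s" "snd s' = snd s"
    "fst s' 16 = fst s 16" "fst s' 17 = fst s 17" "fst s' 18 = fst s 18"
  shows "probed n D m S s'"
  using assms unfolding probed_def by simp

lemma probed_insert:
  assumes "probed n D m S s"
    and "x < y \<Longrightarrow> {x, y} \<notin> D \<Longrightarrow> card (covered {..<n} (insert {x, y} D)) \<le> fst s 16"
  shows "probed n D m (insert (x, y) S) s"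
  using assms unfolding probed_def by (simp only: insert_iff prod.inject) blast

lemma probed_insert_improvement:
  assumes I: "probed n D m S s" and xy: "x < y" "y < n" "{x, y} \<notin> D"
    and less: "fst s 16 < card (covered {..<n} (insert {x, y} D))"
    and s': "snd s' = m" "fst s' 16 = card (covered {..<n} (insert {x, y} D))"
      "fst s' 17 = x * n + y" "fst s' 18 = y * n + x"
  shows "probed n D m (insert (x, y) S) s'"
proof (rule probed_insert)
  have D: "card (covered {..<n} D) \<le> fst s 16"
    using I by (simp add: probed_def)
  have "y * n + x \<noteq> 0"
    using xy by auto
  then have "fst s' 18 \<noteq> 0"
    using s'(4) by metis
  moreover have "\<exists>u v. u < v \<and> v < n \<and> {u, v} \<notin> D \<and> fst s' 17 = u * n + v \<and>
      fst s' 18 = v * n + u \<and> fst s' 16 = card (covered {..<n} (insert {u, v} D)) \<and>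
      card (covered {..<n} D) < fst s' 16"
    using xy s' less D by (intro exI[of _ x] exI[of _ y]) simp
  moreover have "card (covered {..<n} (insert {u, v} D)) \<le> fst s' 16"
    if "(u, v) \<in> S" "u < v" "v < n" "{u, v} \<notin> D" for u v
    using I that less s'(2) by (fastforce simp: probed_def)
  ultimately show "probed n D m S s'"
    using s'(1,2) less D by (simp add: probed_def)
qed (simp add: s')

lemma wlp_probe:
  assumes G: "simple_graph {..<n} (E \<union> F)" and m: "represents n E F m"
    and xy: "x < n" "y < n"
    and s: "fst s 0 = n" "fst s 4 = x" "fst s 5 = x * n" "fst s 6 = y" "fst s 7 = y * n"
    and I: "probed n (E \<union> F) m S s"
  shows "wlp probe (probed n (E \<union> F) m (insert (x, y) S)) s"
proof -
  have snd_s: "snd s = m"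
    using I by (simp add: probed_def)
  have nz: "m (x * n + y) \<noteq> 0 \<longleftrightarrow> {x, y} \<in> E \<union> F"
    using m xy by (auto simp: represents_def)
  show ?thesis
  proof (cases "{x, y} \<in> E \<union> F \<or> \<not> x < y")
    case True
    then have "probed n (E \<union> F) m (insert (x, y) S) s"
      using I by (intro probed_insert) auto
    with True show ?thesis
      using nz s snd_s by (auto simp: probe_def cell_def)
  next
    case False
    define C where "C = card (covered {..<n} (insert {x, y} (E \<union> F)))"
    define m' where "m' = m(x * n + y := 2, y * n + x := 2)"
    have "{x, y} \<in> non_edges {..<n} (E \<union> F)"
      using False xy by (auto simp: non_edges_doubleton)
    with G have "simple_graph {..<n} (E \<union> insert {x, y} F)"
      using simple_graph_insert_non_edge by simp
    moreover have "represents n E (insert {x, y} F) m'"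
      unfolding m'_def using represents_insert[OF m] xy False by simp
    ultimately have "card {v. v < n \<and> mem_covered n m' v} = C"
      using card_mem_covered[of n E "insert {x, y} F" m'] by (simp add: C_def)
    with wlp_count_covered[of "(fst s, m')" n] s(1)
    have count: "wlp count_covered (\<lambda>s'. fst s' 14 = C) (fst s, m')"
      by simp
    \<comment> \<open>Both cells of a non-edge were zero, so clearing them restores the memory
      exactly.\<close>
    have "m (x * n + y) = 0" "m (y * n + x) = 0"
      using False m xy by (auto simp: represents_def insert_commute)
    then have undo: "m'(x * n + y := 0, y * n + x := 0) = m"
      by (auto simp: m'_def fun_eq_iff)
    let ?upd = "If (Minus (Reg 14) (Reg 16))
      (Seq (Assign 16 (Reg 14)) (Seq (Assign 17 (cell 4 6)) (Assign 18 (cell 6 4)))) Skip"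
    let ?Q = "probed n (E \<union> F) m (insert (x, y) S)"
    have "wlp count_covered (wlp (Seq (write_pair 0) ?upd) ?Q) (fst s, m')"
      using count
    proof (rule wlp_frame)
      fix s' assume C': "fst s' 14 = C"
        and "\<And>z. z \<notin> assigned count_covered \<Longrightarrow> fst s' z = fst (fst s, m') z"
        and "store_free count_covered \<Longrightarrow> snd s' = snd (fst s, m')"
      then have m2: "snd s' = m'" and f: "\<And>z. z < 8 \<or> z > 15 \<Longrightarrow> fst s' z = fst s z"
        by auto
      have eq: "wlp (Seq (write_pair 0) ?upd) ?Q s' = wlp ?upd ?Q (fst s', m)"
        using f s by (simp add: write_pair_def cell_def m2 undo)
      have I': "probed n (E \<union> F) m S (fst s', m)"
        using I by (rule probed_cong) (use f snd_s in auto)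
      show "wlp (Seq (write_pair 0) ?upd) ?Q s'"
      proof (cases "C \<le> fst s' 16")
        case True
        then have "?Q (fst s', m)"
          using I' by (intro probed_insert) (simp_all add: C_def)
        with True C' show ?thesis
          unfolding eq by simp
      next
        case less: False
        have "?Q ((fst s')(16 := C, 17 := x * n + y, 18 := y * n + x), m)"
          using I' by (rule probed_insert_improvement) (use less False xy in \<open>simp_all add: C_def\<close>)
        with less C' show ?thesis
          unfolding eq using f s by (simp add: cell_def)
      qed
    qed
    then show ?thesis
      using False nz s snd_s by (simp add: probe_def write_pair_def cell_def m'_def)
  qed
qed

lemma wlp_greedy_round:
  assumes G: "simple_graph {..<n} (E \<union> F)" and m: "represents n E F (snd s)" and n: "fst s 0 = n"
  shows "wlp greedy_round
    (\<lambda>s'. \<exists>F'. represents n E F' (snd s') \<and> greedy_step {..<n} E F F') s"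
proof -
  define m where "m = snd s"
  define D where "D = E \<union> F"
  let ?Q = "\<lambda>s'. \<exists>F'. represents n E F' (snd s') \<and> greedy_step {..<n} E F F'"
  let ?upd = "If (Reg 18) (Seq (Store (Reg 17) (Const 2)) (Store (Reg 18) (Const 2))) Skip"
  have loop: "wlp (Loop 4 (Loop 6 probe)) (wlp ?upd ?Q) s1"
    if s1: "fst s1 0 = n" "probed n D m {} s1" for s1
    using s1(1)
  proof (rule wlp_Loop[where I = "\<lambda>i. probed n D m {(x, y). x < i}"])
    show "probed n D m {(x, y). x < 0} ((fst s1)(4 := 0, Suc 4 := 0), snd s1)"
      using s1(2) by (simp add: probed_def)
  next
    fix i s2 assume s2: "i < n" "probed n D m {(x, y). x < i} s2" "fst s2 0 = n"
      "fst s2 4 = i" "fst s2 (Suc 4) = i * n"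
    show "wlp (Loop 6 probe) (\<lambda>s'. probed n D m {(x, y). x < Suc i}
        ((fst s')(4 := Suc i, Suc 4 := Suc i * n), snd s')) s2"
      using s2(3)
    proof (rule wlp_Loop[where I = "\<lambda>j s'. probed n D m {(x, y). x < i \<or> x = i \<and> y < j} s' \<and>
        fst s' 4 = i \<and> fst s' 5 = i * n"])
      fix j s3 assume s3: "j < n" "probed n D m {(x, y). x < i \<or> x = i \<and> y < j} s3 \<and>
          fst s3 4 = i \<and> fst s3 5 = i * n"
        "fst s3 0 = n" "fst s3 6 = j" "fst s3 (Suc 6) = j * n"
      have "wlp probe (probed n D m (insert (i, j) {(x, y). x < i \<or> x = i \<and> y < j})) s3"
        unfolding D_def
        by (rule wlp_probe[OF G]) (use s2 s3 assms(2) in \<open>simp_all add: m_def D_def\<close>)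
      moreover have "insert (i, j) {(x, y). x < i \<or> x = i \<and> y < j} = {(x, y). x < i \<or> x = i \<and> y < Suc j}"
        by auto
      ultimately have "wlp probe (probed n D m {(x, y). x < i \<or> x = i \<and> y < Suc j}) s3"
        by simp
      then show "wlp probe (\<lambda>s'. probed n D m {(x, y). x < i \<or> x = i \<and> y < Suc j}
          ((fst s')(6 := Suc j, Suc 6 := Suc j * n), snd s') \<and>
          fst ((fst s')(6 := Suc j, Suc 6 := Suc j * n), snd s') 4 = i \<and>
          fst ((fst s')(6 := Suc j, Suc 6 := Suc j * n), snd s') 5 = i * n) s3"
        by (rule wlp_frame) (use s3 in \<open>auto elim: probed_cong\<close>)
    next
      show "probed n D m {(x, y). x < i \<or> x = i \<and> y < 0} ((fst s2)(6 := 0, Suc 6 := 0), snd s2) \<and>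
          fst ((fst s2)(6 := 0, Suc 6 := 0), snd s2) 4 = i \<and>
          fst ((fst s2)(6 := 0, Suc 6 := 0), snd s2) 5 = i * n"
        using s2 by (auto elim: probed_cong)
    next
      fix s3 assume "probed n D m {(x, y). x < i \<or> x = i \<and> y < n} s3 \<and>
          fst s3 4 = i \<and> fst s3 5 = i * n"
      \<comment> \<open>The two sets differ only in pairs with \<open>y \<ge> n\<close>, which
        \<open>probed\<close> ignores.\<close>
      then show "probed n D m {(x, y). x < Suc i} ((fst s3)(4 := Suc i, Suc 4 := Suc i * n), snd s3)"
        by (auto simp: probed_def less_Suc_eq)
    qed auto
  next
    fix s2 assume s2: "probed n D m {(x, y). x < n} s2"
    have max: "card (covered {..<n} (insert e D)) \<le> fst s2 16" if "e \<in> non_edges {..<n} D" for e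
    proof -
      from that obtain x y where e: "e = {x, y}" "x < n" "y < n" "x \<noteq> y" "e \<notin> D"
        by (auto elim!: non_edgesE)
      \<comment> \<open>Only increasing pairs are recorded by \<open>probed\<close>, so the non-edge
        is oriented first.\<close>
      then have "e = {min x y, max x y}" "min x y < max x y"
        by (auto simp: min_def max_def insert_commute)
      with e s2 show ?thesis
        unfolding probed_def by (smt (verit) case_prodI max_less_iff_conj mem_Collect_eq order_less_trans)
    qed
    show "wlp ?upd ?Q s2"
    proof (cases "fst s2 18 = 0")
      case True
      \<comment> \<open>Register 18 is zero, so the best count is still that of the current graph
        and no non-edge improves on it.\<close>
      then have "greedy_step {..<n} E F F"
        using max s2 by (simp add: greedy_step_def probed_def D_def)
      moreover have "represents n E F (snd s2)"
        using s2 assms(2) by (simp add: probed_def m_def)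
      ultimately show ?thesis
        using True by auto
    next
      case False
      with s2 obtain x y where xy: "x < y" "y < n" "{x, y} \<notin> D" "fst s2 17 = x * n + y"
        "fst s2 18 = y * n + x" "fst s2 16 = card (covered {..<n} (insert {x, y} D))"
        "card (covered {..<n} D) < fst s2 16"
        by (auto simp: probed_def)
      have "{x, y} \<in> non_edges {..<n} D"
        using xy by (simp add: non_edges_doubleton)
      then have "greedy_step {..<n} E F (insert {x, y} F)"
        using max xy by (auto simp: greedy_step_def D_def)
      moreover have "represents n E (insert {x, y} F) (m(x * n + y := 2, y * n + x := 2))"
        using xy assms(2) by (intro represents_insert) (auto simp: D_def m_def)
      moreover have "snd s2 = m"
        using s2 by (simp add: probed_def)
      ultimately show ?thesis
        using False xy by auto
    qed
  qed auto
  have "card {v. v < n \<and> mem_covered n m v} = card (covered {..<n} D)"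
    unfolding D_def using card_mem_covered[OF G] assms(2) by (simp add: m_def)
  with wlp_count_covered[OF n]
  have "wlp count_covered (\<lambda>s'. fst s' 14 = card (covered {..<n} D)) s"
    by (simp add: m_def)
  then have "wlp count_covered (wlp (Seq (Assign 16 (Reg 14)) (Seq (Assign 18 (Const 0))
      (Seq (Loop 4 (Loop 6 probe)) ?upd))) ?Q) s"
  proof (rule wlp_frame)
    fix s' assume "fst s' 14 = card (covered {..<n} D)"
      and "\<And>z. z \<notin> assigned count_covered \<Longrightarrow> fst s' z = fst s z"
      and "store_free count_covered \<Longrightarrow> snd s' = snd s"
    then have "wlp (Loop 4 (Loop 6 probe)) (wlp ?upd ?Q) ((fst s')(16 := fst s' 14, 18 := 0), snd s')"
      using n by (intro loop) (auto simp: probed_def m_def)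
    then show "wlp (Seq (Assign 16 (Reg 14)) (Seq (Assign 18 (Const 0))
        (Seq (Loop 4 (Loop 6 probe)) ?upd))) ?Q s'"
      by (simp del: wlp_If)
  qed
  then show ?thesis
    by (simp add: greedy_round_def del: wlp_If)
qed

lemma wlp_finalize:
  assumes F: "F \<subseteq> non_edges {..<n} E" and m: "represents n E F (snd s)" and n: "fst s 0 = n"
  shows "wlp (Loop 4 (Loop 6 (Store (cell 4 6) (Minus (Mem (cell 4 6)) (Const 1)))))
    (\<lambda>s'. outputs n s' F) s"
proof -
  define cleared where "cleared S s' \<longleftrightarrow> (\<forall>x<n. \<forall>y<n. snd s' (x * n + y) =
      (if (x, y) \<in> S then (if {x, y} \<in> F then 1 else 0) else snd s (x * n + y)))"
    for S :: "(nat \<times> nat) set" and s' :: state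
  show ?thesis
    using n
  proof (rule wlp_Loop[where I = "\<lambda>i. cleared {(x, y). x < i}"])
    fix i s2 assume s2: "i < n" "cleared {(x, y). x < i} s2" "fst s2 0 = n" "fst s2 4 = i" "fst s2 (Suc 4) = i * n"
    show "wlp (Loop 6 (Store (cell 4 6) (Minus (Mem (cell 4 6)) (Const 1))))
       (\<lambda>s'. cleared {(x, y). x < Suc i} ((fst s')(4 := Suc i, Suc 4 := Suc i * n), snd s')) s2"
      using s2(3)
    proof (rule wlp_Loop[where I = "\<lambda>j s'. cleared {(x, y). x < i \<or> x = i \<and> y < j} s' \<and>
        fst s' 4 = i \<and> fst s' 5 = i * n"])
      fix j s3 assume s3: "j < n" "cleared {(x, y). x < i \<or> x = i \<and> y < j} s3 \<and>
          fst s3 4 = i \<and> fst s3 5 = i * n"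
        "fst s3 0 = n" "fst s3 6 = j" "fst s3 (Suc 6) = j * n"
      \<comment> \<open>Truncated subtraction sends 0, 1, 2 to 0, 0, 1. As \<open>F\<close> consists
        of non-edges, every added edge carries the mark 2.\<close>
      have val: "snd s3 (i * n + j) - 1 = (if {i, j} \<in> F then 1 else 0)"
        using s2(1) s3 F m by (auto simp: cleared_def represents_def non_edges_def)
      have eq: "x * n + y = i * n + j \<longleftrightarrow> x = i \<and> y = j" if "y < n" for x y
        using cell_eq_iff[OF that s3(1)] .
      have "cleared {(x, y). x < i \<or> x = i \<and> y < Suc j} (r, (snd s3)(i * n + j := snd s3 (i * n + j) - 1))" for r
        using s3 unfolding cleared_def val by (auto simp: eq less_Suc_eq)
      then show "wlp (Store (cell 4 6) (Minus (Mem (cell 4 6)) (Const 1)))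
         (\<lambda>s'. cleared {(x, y). x < i \<or> x = i \<and> y < Suc j}
           ((fst s')(6 := Suc j, Suc 6 := Suc j * n), snd s') \<and>
           fst ((fst s')(6 := Suc j, Suc 6 := Suc j * n), snd s') 4 = i \<and>
           fst ((fst s')(6 := Suc j, Suc 6 := Suc j * n), snd s') 5 = i * n) s3"
        using s3 by (simp add: cell_def)
    qed (use s2 in \<open>auto simp: cleared_def less_Suc_eq\<close>)
  next
    fix s2 assume s2: "cleared {(x, y). x < n} s2"
    show "outputs n s2 F"
      unfolding outputs_def
    proof (intro allI impI)
      fix a assume a: "a < n * n"
      then have "0 < n"
        by (cases n) auto
      then have "a div n < n" "a mod n < n"
        using a by (auto simp: less_mult_imp_div_less)
      moreover have "\<forall>x<n. \<forall>y<n. snd s2 (x * n + y) = (if {x, y} \<in> F then 1 else 0)"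
        using s2 by (simp add: cleared_def)
      ultimately have "snd s2 (a div n * n + a mod n) = (if {a div n, a mod n} \<in> F then 1 else 0)"
        by blast
      then show "snd s2 a = adjacency_matrix n F a"
        using a by (simp add: adjacency_matrix_def)
    qed
  qed (auto simp: cleared_def)
qed

lemma represents_input: "represents n E {} (snd (input_state n E))"
  using cell_less by (auto simp: represents_def input_state_def adjacency_matrix_def)

lemma wlp_greedy_completion:
  assumes G: "simple_graph {..<n} E" and L: "large_components {..<n} E"
  shows "wlp greedy_completion (\<lambda>s. \<exists>F. outputs n s F \<and> completion_set {..<n} E F \<and>
    real (card F) \<le> (ln (real n) + 1) * real (min_completion {..<n} E)) (input_state n E)"
proof -
  let ?Q = "\<lambda>s. \<exists>F. outputs n s F \<and> completion_set {..<n} E F \<and>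
    real (card F) \<le> (ln (real n) + 1) * real (min_completion {..<n} E)"
  define I where "I i s \<longleftrightarrow> (\<exists>F. represents n E F (snd s) \<and> greedy_invariant {..<n} E i F)"
    for i and s :: state
  have n: "fst (input_state n E) 0 = n"
    by (simp add: input_state_def)
  show ?thesis
    unfolding greedy_completion_def wlp_Seq using n
  proof (rule wlp_Loop[where I = I])
    show "I 0 ((fst (input_state n E))(2 := 0, Suc 2 := 0), snd (input_state n E))"
      using represents_input[of n E] greedy_invariant_init[of "{..<n}" E] by (auto simp: I_def)
  next
    fix i s assume s: "i < n" "I i s" "fst s 0 = n"
    then obtain F where F: "represents n E F (snd s)" "greedy_invariant {..<n} E i F"
      by (auto simp: I_def)
    then have "simple_graph {..<n} (E \<union> F)"
      using simple_graph_Un_non_edges[OF G] by (simp add: greedy_invariant_def)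
    from wlp_greedy_round[OF this F(1) s(3)]
    show "wlp greedy_round (\<lambda>s'. I (Suc i) ((fst s')(2 := Suc i, Suc 2 := Suc i * n), snd s')) s"
      by (rule wlp_mono) (use greedy_invariant_step[OF G L F(2)] in \<open>auto simp: I_def\<close>)
  next
    fix s assume s: "I n s" "fst s 0 = n"
    then obtain F where F: "represents n E F (snd s)" "greedy_invariant {..<n} E n F"
      by (auto simp: I_def)
    then have "F \<subseteq> non_edges {..<n} E"
      by (simp add: greedy_invariant_def)
    from wlp_finalize[OF this F(1) s(2)]
    show "wlp (Loop 4 (Loop 6 (Store (cell 4 6) (Minus (Mem (cell 4 6)) (Const 1))))) ?Q s"
      by (rule wlp_mono) (use greedy_invariant_final[of "{..<n}" E F] F(2) in auto)
  qed auto
qed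

theorem theorem5p2:
  "\<exists>(c :: com) (p :: nat poly). \<forall>(n :: nat) (E :: nat set set).
     simple_graph {..<n} E \<longrightarrow> (\<forall>C \<in> connected_components {..<n} E. card C \<ge> 3) \<longrightarrow>
     (\<exists>t s F. exec c (input_state n E) t s \<and> t \<le> poly p n \<and> outputs n s F \<and>
        completion_set {..<n} E F \<and>
        real (card F) \<le> (ln (real n) + 1) * real (min_completion {..<n} E))"
proof -
  obtain p where p: "\<And>s. \<exists>t s'. exec greedy_completion s t s' \<and> t \<le> poly p (fst s 0)"
    using polytime_greedy_completion unfolding polytime_def by blast
  show ?thesis
  proof (intro exI[of _ greedy_completion] exI[of _ p] allI impI)
    fix n :: nat and E :: "nat set set"
    assume G: "simple_graph {..<n} E" "\<forall>C \<in> connected_components {..<n} E. card C \<ge> 3"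
    \<comment> \<open>The time bound supplies a halting run, to which partial correctness then
      applies.\<close>
    obtain t s where "exec greedy_completion (input_state n E) t s" "t \<le> poly p n"
      using p[of "input_state n E"] by (auto simp: input_state_def)
    with wlp_greedy_completion[OF G(1) large_components_if_card_ge_3[OF G]]
    show "\<exists>t s F. exec greedy_completion (input_state n E) t s \<and> t \<le> poly p n \<and> outputs n s F \<and>
        completion_set {..<n} E F \<and>
        real (card F) \<le> (ln (real n) + 1) * real (min_completion {..<n} E)"
      unfolding wlp_def by blast
  qed
qed

end
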